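(* Let $m\ge 2$ be an integer and let $(\Sigma,\sigma)$ be the one-sided full shift on $m$ symbols with metric $d$. Let $\varphi:\mathbb{N}\to\mathbb{R}^+$ be a monotonically increasing function, and put $$\delta=\liminf_{n\to\infty}\frac{\varphi(n)}{\log n},\qquad \gamma=\limsup_{n\to\infty}\frac{\varphi(n)}{\log n}.$$ For $0\le\alpha\le\beta\le\infty$ let $$E^\varphi_{\alpha,\beta}=\left\{x\in\Sigma: \liminf_{n\to\infty}\frac{\log R_n(x)}{\varphi(n)}=\alpha,\ \limsup_{n\to\infty}\frac{\log R_n(x)}{\varphi(n)}=\beta\right\}.$$ Then for any $0\le\alpha\le\beta\le\infty$, $$\dim_{\rm H}(E^\varphi_{\alpha,\beta})=\begin{cases}1, &\text{if } \alpha\ge\frac1\gamma \text{ and } \beta\ge\frac1\delta,\\ 0,&\text{otherwise},\end{cases}$$ with the convention $\frac10=\infty$ and $\frac1\infty=0$.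
   Context: $\Sigma=\{0,1,\dots,m-1\}^{\mathbb{N}}$ with $\mathbb{N}=\{1,2,\dots\}$, and $\sigma(x)=(x_{i+1})_{i\ge1}$ for $x=(x_i)_{i\ge 1}\in\Sigma$. The metric on $\Sigma$ is $d(x,y)=m^{-\inf\{k\ge 0:\ x_{k+1}\ne y_{k+1}\}}$ (so $d(x,x)=0$). For $n\ge1$ and $x\in\Sigma$ the first return time is $$R_n(x)=\inf\{j\ge 1:\ x_{j+1}x_{j+2}\cdots x_{j+n}=x_1x_2\cdots x_n\},$$ with $\inf\emptyset=\infty$ and $\log\infty=\infty$. $\log$ is the natural logarithm. $\mathbb{R}^+$ denotes the positive reals. $\dim_{\rm H}$ denotes Hausdorff dimension with respect to $d$ (the empty set has dimension $0$). The quantities $\delta,\gamma$, $\alpha$, $\beta$ may take the values $0$ and $\infty$. *)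

theory Defs
  imports "HOL-Analysis.Analysis"
begin

context Metric_space
begin

text \<open>The supremum is taken in \<^typ>\<open>ennreal\<close>, so unbounded sets have diameter \<open>\<infinity>\<close> and
  the empty set has diameter \<open>0\<close>.\<close>

definition mdiam :: "'a set \<Rightarrow> ennreal" where
  "mdiam U = (SUP x\<in>U. SUP y\<in>U. ennreal (d x y))"

text \<open>The cost \<open>|U|\<^sup>s\<close> of a covering set. The empty set costs nothing, and \<open>0\<^sup>0 = 1\<close> for a
  singleton, whereas \<^term>\<open>(0::real) powr 0\<close> is \<open>0\<close>. The function \<^const>\<open>enn2real\<close> loses nothing
  here because only sets of finite diameter are used in \<open>hausdorff_premeasure\<close> below.\<close>

definition mdiam_powr :: "real \<Rightarrow> 'a set \<Rightarrow> ennreal" where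
  "mdiam_powr s U =
    (if U = {} then 0 else if s = 0 then 1 else ennreal (enn2real (mdiam U) powr s))"

text \<open>Countable covers are sequences; finite ones are padded with empty sets.\<close>

definition hausdorff_premeasure :: "real \<Rightarrow> real \<Rightarrow> 'a set \<Rightarrow> ennreal" where
  "hausdorff_premeasure s \<epsilon> A =
    (INF U \<in> {U :: nat \<Rightarrow> 'a set. A \<subseteq> (\<Union>i. U i) \<and> (\<forall>i. U i \<subseteq> M \<and> mdiam (U i) \<le> ennreal \<epsilon>)}.
      \<Sum>i. mdiam_powr s (U i))"

definition hausdorff_measure :: "real \<Rightarrow> 'a set \<Rightarrow> ennreal" where
  "hausdorff_measure s A = (SUP \<epsilon>\<in>{0<..}. hausdorff_premeasure s \<epsilon> A)"

definition hausdorff_dim :: "'a set \<Rightarrow> ereal" where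
  "hausdorff_dim A = (INF s \<in> {s. 0 \<le> s \<and> hausdorff_measure s A = 0}. ereal s)"

end

text \<open>Sequences are indexed from \<open>0\<close>: the value \<open>x i\<close> is the symbol \<open>x\<^sub>i\<^sub>+\<^sub>1\<close> of the sequence
  \<open>x\<^sub>1 x\<^sub>2 \<dots>\<close>.\<close>

definition full_shift :: "nat \<Rightarrow> (nat \<Rightarrow> nat) set" where
  "full_shift m = {x. \<forall>i. x i < m}"

definition shift_dist :: "nat \<Rightarrow> (nat \<Rightarrow> nat) \<Rightarrow> (nat \<Rightarrow> nat) \<Rightarrow> real" where
  "shift_dist m x y = (if x = y then 0 else real m powr - real (LEAST k. x k \<noteq> y k))"

lemma shift_dist_ultrametric:
  assumes "m \<ge> 1"
  shows "shift_dist m x z \<le> max (shift_dist m x y) (shift_dist m y z)"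
proof (cases "x = y \<or> y = z \<or> x = z")
  case True
  then show ?thesis by (auto simp: shift_dist_def le_max_iff_disj)
next
  case False
  let ?k = "LEAST k. x k \<noteq> z k"
  let ?a = "LEAST k. x k \<noteq> y k"
  let ?b = "LEAST k. y k \<noteq> z k"
  from False have "\<exists>k. x k \<noteq> z k" by auto
  then have "x ?k \<noteq> z ?k" by (rule LeastI_ex)
  then have "x ?k \<noteq> y ?k \<or> y ?k \<noteq> z ?k" by auto
  then have "?a \<le> ?k \<or> ?b \<le> ?k" by (auto intro: Least_le)
  then have "real m powr - real ?k \<le> real m powr - real ?a
      \<or> real m powr - real ?k \<le> real m powr - real ?b"
    using assms by (auto intro!: powr_mono)
  then show ?thesis using False by (auto simp: shift_dist_def)
qed

interpretation shift_space: Metric_space "full_shift m" "shift_dist m" for m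
proof
  show "0 \<le> shift_dist m x y" for x y by (simp add: shift_dist_def)
  show "shift_dist m x y = shift_dist m y x" for x y
    by (simp add: shift_dist_def eq_commute)
  show "shift_dist m x y = 0 \<longleftrightarrow> x = y" if "x \<in> full_shift m" "y \<in> full_shift m" for x y
    using that by (auto simp: shift_dist_def full_shift_def)
  show "shift_dist m x z \<le> shift_dist m x y + shift_dist m y z"
    if "x \<in> full_shift m" "y \<in> full_shift m" "z \<in> full_shift m" for x y z
  proof -
    have "m \<ge> 1"
      using that(1) by (cases m) (auto simp: full_shift_def)
    then have "shift_dist m x z \<le> max (shift_dist m x y) (shift_dist m y z)"
      by (rule shift_dist_ultrametric)
    moreover have "0 \<le> shift_dist m x y" "0 \<le> shift_dist m y z"
      by (simp_all add: shift_dist_def)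
    ultimately show ?thesis by simp
  qed
qed

text \<open>The infimum is taken in \<^typ>\<open>enat\<close>, so it is \<open>\<infinity>\<close> if the initial word never recurs.\<close>

definition return_time :: "nat \<Rightarrow> (nat \<Rightarrow> nat) \<Rightarrow> enat" where
  "return_time n x = (INF j \<in> {j. 1 \<le> j \<and> (\<forall>i<n. x (j + i) = x i)}. enat j)"

definition ln_enat :: "enat \<Rightarrow> ereal" where
  "ln_enat k = (case k of enat j \<Rightarrow> ereal (ln (real j)) | \<infinity> \<Rightarrow> \<infinity>)"

definition recurrence_set :: "nat \<Rightarrow> (nat \<Rightarrow> real) \<Rightarrow> ereal \<Rightarrow> ereal \<Rightarrow> (nat \<Rightarrow> nat) set" where
  "recurrence_set m \<phi> \<alpha> \<beta> = {x \<in> full_shift m.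
     liminf (\<lambda>n. ln_enat (return_time n x) / ereal (\<phi> n)) = \<alpha> \<and>
     limsup (\<lambda>n. ln_enat (return_time n x) / ereal (\<phi> n)) = \<beta>}"

end

theory Submission
  imports Defs "HOL-Probability.Infinite_Product_Measure" "HOL-Library.Discrete_Functions"
    "HOL-Real_Asymp.Real_Asymp"
begin

text \<open>The dimension drops to \<open>0\<close> because an early return is a strong restriction. If \<open>\<alpha> < 1 / \<gamma>\<close> or
\<open>\<beta> < 1 / \<delta>\<close>, then there is one exponent \<open>r < 1\<close> such that every point \<open>x\<close> of the set has
\<open>R\<^sub>n(x) \<le> n\<^sup>r\<close> for infinitely many \<open>n\<close>: in the first case, for suitable \<open>\<alpha> < r1 < r2 < 1 / \<gamma>\<close>,
\<open>ln R\<^sub>n < r1 \<phi> n\<close> infinitely often and \<open>\<phi> n < ln n / r2\<close> eventually; in the second case the roles of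
``infinitely often'' and ``eventually'' are exchanged. A return at time \<open>j \<le> h\<close> makes the first \<open>n\<close>
symbols periodic, hence there are at most \<open>h m\<^sup>h\<close> such words, which is subexponential in \<open>n\<close> when
\<open>h = n\<^sup>r\<close>. The cylinders over these words give convergent covering sums for every positive
dimension parameter (\<open>hausdorff_dim_early_return_eq_0\<close>).

Otherwise a set of dimension \<open>1\<close> is found inside. Its core is
\<open>hausdorff_dim_prescribed_return_times\<close>: for monotone \<open>\<kappa>\<close> with \<open>n / 2^\<kappa>(n) \<longlonglongrightarrow> 0\<close>, the points with
\<open>R\<^sub>n = 2^\<kappa>(n)\<close> for all large \<open>n\<close> have dimension \<open>1\<close>. Such points are written down symbol by symbol.
They start with the marker \<open>0\<^sup>N 1\<close>; at position \<open>2^k\<close> the initial word of length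
\<open>l k = max {n. \<kappa> n \<le> k}\<close> is copied, then a symbol breaks the match, then \<open>l k\<close> ones follow;
elsewhere every multiple of \<open>N\<close> carries a \<open>1\<close>, which prevents the block \<open>0\<^sup>N\<close> from
starting anywhere but at the beginning and inside the copies, and all other symbols are free. Returns of long initial words can then
only start inside copies, and the run of ones prevents a match from reaching beyond the end of the
copy (\<open>copying_recurrence\<close>). As \<open>l k\<close> is small against \<open>2^k\<close>, the free positions have lower density at least \<open>1 - 2 / N\<close>,
and the uniform Bernoulli measure on the free symbols, by the mass
distribution principle, bounds the dimension from below by every \<open>s < 1\<close>.

It remains to choose \<open>\<kappa>\<close>. The only restriction is that \<open>\<kappa>(n) ln 2\<close> be monotone and a little larger than
\<open>ln n\<close>. For finite \<open>\<alpha>\<close> one takes the maximum of \<open>\<alpha> \<phi>\<close>, of a barrier \<open>L\<close> asymptotic to \<open>ln n\<close>,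
and of a step function that jumps to \<open>\<beta> \<phi>\<close> at very sparse places (\<open>exists_rate\<close>). The hypothesis
\<open>\<alpha> \<ge> 1 / \<gamma>\<close> says that the barrier is infinitely often no obstacle to the lower limit \<open>\<alpha>\<close>, and
\<open>\<beta> \<ge> 1 / \<delta>\<close> says that it never pushes the upper limit above \<open>\<beta>\<close>.\<close>

section \<open>Hausdorff measure and dimension in metric spaces\<close>

context Metric_space
begin

lemma hausdorff_measure_mono:
  assumes "A \<subseteq> B"
  shows "hausdorff_measure s A \<le> hausdorff_measure s B"
  unfolding hausdorff_measure_def hausdorff_premeasure_def
  using assms by (intro SUP_mono' INF_superset_mono) auto

lemma hausdorff_dim_mono:
  assumes "A \<subseteq> B"
  shows "hausdorff_dim A \<le> hausdorff_dim B"
proof -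
  have "hausdorff_measure s A = 0" if "hausdorff_measure s B = 0" for s
    using hausdorff_measure_mono[OF assms, of s] that by simp
  then show ?thesis
    unfolding hausdorff_dim_def by (intro INF_superset_mono) auto
qed

lemma hausdorff_dim_nonneg: "0 \<le> hausdorff_dim A"
  unfolding hausdorff_dim_def by (auto intro: INF_greatest)

lemma hausdorff_dim_leI:
  assumes "\<And>s. s > c \<Longrightarrow> hausdorff_measure s A = 0" "0 \<le> c"
  shows "hausdorff_dim A \<le> ereal c"
proof (rule ereal_le_epsilon2)
  fix e :: real assume "0 < e"
  then show "hausdorff_dim A \<le> ereal c + ereal e"
    unfolding hausdorff_dim_def using assms by (intro INF_lower2[of "c + e"]) auto
qed

lemma hausdorff_dim_geI:
  assumes "\<And>s. 0 \<le> s \<Longrightarrow> s < c \<Longrightarrow> hausdorff_measure s A \<noteq> 0"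
  shows "ereal c \<le> hausdorff_dim A"
  unfolding hausdorff_dim_def using assms by (intro INF_greatest) (force simp: not_less)

lemma mdiam_empty: "mdiam {} = 0"
  unfolding mdiam_def image_empty Sup_empty by (rule bot_ennreal)

lemma mdiam_powr_empty: "mdiam_powr s {} = 0"
  by (simp add: mdiam_powr_def)

lemma mdiam_powr_le:
  assumes "mdiam U \<le> ennreal r" "0 < s" "0 \<le> r"
  shows "mdiam_powr s U \<le> ennreal (r powr s)"
proof -
  have "enn2real (mdiam U) \<le> r"
    using enn2real_mono[OF assms(1)] assms(3) by simp
  then show ?thesis
    using assms by (auto simp: mdiam_powr_def intro!: ennreal_leI powr_mono2)
qed

text \<open>The Hausdorff analogue of the Borel--Cantelli lemma: the points that lie in infinitely many of the
sets \<open>\<Union>(\<C> n)\<close> are covered by all \<open>\<C> n\<close> with \<open>n \<ge> n0\<close> together, at a cost that is the tail of a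
convergent series.\<close>

lemma hausdorff_measure_limsup_eq_0:
  fixes \<C> :: "nat \<Rightarrow> 'a set set" and r :: "nat \<Rightarrow> real"
  assumes fin: "\<And>n. finite (\<C> n)"
    and sub: "\<And>n U. U \<in> \<C> n \<Longrightarrow> U \<subseteq> M"
    and diam: "\<And>n U. U \<in> \<C> n \<Longrightarrow> mdiam U \<le> ennreal (r n)"
    and r: "\<And>n. 0 \<le> r n" "r \<longlonglongrightarrow> 0" and s: "0 < s"
    and summ: "summable (\<lambda>n. real (card (\<C> n)) * r n powr s)"
    and cover: "\<And>x. x \<in> A \<Longrightarrow> \<exists>\<^sub>F n in sequentially. x \<in> \<Union>(\<C> n)"
  shows "hausdorff_measure s A = 0"
proof -
  define a where "a n = real (card (\<C> n)) * r n powr s" for n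
  have a0: "a n \<ge> 0" for n by (simp add: a_def)
  obtain h where h: "bij_betw (h n) {0..<card (\<C> n)} (\<C> n)" for n
    using ex_bij_betw_nat_finite[OF fin] by metis
  define V where "V n i = (if i < card (\<C> n) then h n i else {})" for n i
  have V_in: "i < card (\<C> n) \<Longrightarrow> V n i \<in> \<C> n" for n i
    using h[of n] by (auto simp: V_def bij_betw_def)
  have V_cover: "\<exists>i. x \<in> V n i" if "x \<in> \<Union>(\<C> n)" for x n
  proof -
    from that obtain U where U: "U \<in> \<C> n" "x \<in> U" by blast
    from U(1) have "U \<in> h n ` {0..<card (\<C> n)}"
      using bij_betw_imp_surj_on[OF h] by simp
    then obtain i where "i < card (\<C> n)" "U = h n i" by auto
    then show ?thesis using U(2) by (intro exI[of _ i]) (simp add: V_def)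
  qed
  have V_cost: "mdiam_powr s (V n i) \<le> (if i < card (\<C> n) then ennreal (r n powr s) else 0)" for n i
    using V_in[of i n] diam[of "V n i" n] r(1)[of n] s
    by (auto intro!: mdiam_powr_le) (auto simp: V_def mdiam_powr_empty)
  have le: "hausdorff_premeasure s \<epsilon> A \<le> ennreal e" if "\<epsilon> > 0" "e > 0" for \<epsilon> e :: real
  proof -
    have "\<forall>\<^sub>F n in sequentially. r n < \<epsilon>"
      using r(2) \<open>\<epsilon> > 0\<close> by (rule order_tendstoD)
    then obtain n1 where n1: "\<And>n. n \<ge> n1 \<Longrightarrow> r n < \<epsilon>"
      by (auto simp: eventually_sequentially)
    obtain n2 where n2: "\<And>n. n \<ge> n2 \<Longrightarrow> norm (\<Sum>i. a (i + n)) < e"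
      using suminf_exist_split[OF \<open>e > 0\<close>, of a] summ unfolding a_def by auto
    define n0 where "n0 = max n1 n2"
    \<comment> \<open>The families with index at least \<open>n0\<close> are enumerated as one sequence through the pairing function.\<close>
    define W where "W = (\<lambda>(n, i). V (n + n0) i)"
    define U where "U = (\<lambda>k. W (prod_decode k))"
    have "A \<subseteq> (\<Union>k. U k)"
    proof
      fix x assume "x \<in> A"
      from cover[OF this] have "\<exists>n\<ge>n0. x \<in> \<Union>(\<C> n)"
        by (simp only: frequently_sequentially)
      then obtain n where "n \<ge> n0" "x \<in> \<Union>(\<C> n)" by (elim exE conjE)
      moreover from V_cover[OF this(2)] obtain i where "x \<in> V n i" ..
      ultimately have "x \<in> U (prod_encode (n - n0, i))"
        by (simp add: U_def W_def)
      then show "x \<in> (\<Union>k. U k)" by blast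
    qed
    moreover have "U k \<subseteq> M \<and> mdiam (U k) \<le> ennreal \<epsilon>" for k
    proof -
      obtain n i where ni: "prod_decode k = (n, i)" by fastforce
      have Uk: "U k = V (n + n0) i" by (simp add: U_def W_def ni)
      show ?thesis
      proof (cases "i < card (\<C> (n + n0))")
        case True
        have "mdiam (V (n + n0) i) \<le> ennreal (r (n + n0))"
          using diam V_in True by blast
        also have "\<dots> \<le> ennreal \<epsilon>"
          by (rule ennreal_leI[OF less_imp_le[OF n1]]) (simp add: n0_def trans_le_add2)
        finally show ?thesis
          unfolding Uk using sub[OF V_in[OF True]] by blast
      next
        case False
        then have "U k = {}" by (simp add: Uk V_def)
        then show ?thesis by (simp add: mdiam_empty)
      qed
    qed
    ultimately have "hausdorff_premeasure s \<epsilon> A \<le> (\<Sum>k. mdiam_powr s (U k))"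
      unfolding hausdorff_premeasure_def by (intro INF_lower) auto
    also have "\<dots> = (\<Sum>n. \<Sum>i. mdiam_powr s (V (n + n0) i))"
      unfolding U_def
    proof (rule suminf_ennreal_2dimen[where f = "\<lambda>p. mdiam_powr s (W p)", unfolded comp_def])
      show "(\<Sum>i. mdiam_powr s (V (n + n0) i)) = (\<Sum>i. mdiam_powr s (W (n, i)))" for n
        by (simp add: W_def)
    qed
    also have "\<dots> \<le> (\<Sum>n. ennreal (a (n + n0)))"
    proof (intro suminf_le)
      fix n
      let ?N = "n + n0"
      have "(\<Sum>i. mdiam_powr s (V ?N i))
          \<le> (\<Sum>i. if i < card (\<C> ?N) then ennreal (r ?N powr s) else 0)"
        by (rule suminf_le[OF V_cost summableI summableI])
      also have "\<dots> = (\<Sum>i<card (\<C> ?N). ennreal (r ?N powr s))"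
        by (subst suminf_finite[of "{..<card (\<C> ?N)}"]) auto
      also have "\<dots> = ennreal (a ?N)"
        by (simp add: a_def ennreal_mult' ennreal_of_nat_eq_real_of_nat)
      finally show "(\<Sum>i. mdiam_powr s (V ?N i)) \<le> ennreal (a ?N)" .
    qed auto
    also have "\<dots> = ennreal (\<Sum>n. a (n + n0))"
      using summable_ignore_initial_segment[OF summ, of n0] a0
      by (intro suminf_ennreal2) (simp_all add: a_def)
    also have "\<dots> \<le> ennreal e"
      using n2[of n0] by (intro ennreal_leI) (simp add: n0_def abs_le_iff)
    finally show ?thesis .
  qed
  have "hausdorff_premeasure s \<epsilon> A = 0" if "\<epsilon> > 0" for \<epsilon>
  proof -
    have "hausdorff_premeasure s \<epsilon> A \<le> 0"
      by (rule ennreal_le_epsilon) (simp add: le[OF that])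
    then show ?thesis by simp
  qed
  then show ?thesis
    unfolding hausdorff_measure_def by simp
qed

text \<open>The mass distribution principle, for the image of \<open>P\<close> under \<open>\<Phi>\<close>. Only the outer measure of the
preimages of covering sets enters, through their measurable supersets \<open>D\<close>, so that \<open>\<Phi>\<close> can be any map
and a covering set any set.\<close>

lemma hausdorff_measure_neq_0I:
  assumes P: "prob_space P" and \<Phi>: "\<And>y. y \<in> space P \<Longrightarrow> \<Phi> y \<in> A" and K: "K < \<infinity>"
    and D: "\<And>U. U \<subseteq> M \<Longrightarrow> \<exists>D\<in>sets P. {y \<in> space P. \<Phi> y \<in> U} \<subseteq> D
              \<and> emeasure P D \<le> K * mdiam_powr s U"
  shows "hausdorff_measure s A \<noteq> 0"
proof -
  have *: "1 \<le> K * (\<Sum>i. mdiam_powr s (U i))" if U: "A \<subseteq> (\<Union>i. U i)" "\<And>i. U i \<subseteq> M" for U :: "nat \<Rightarrow> 'a set"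
  proof -
    from D U(2) have "\<forall>i. \<exists>D\<in>sets P. {y \<in> space P. \<Phi> y \<in> U i} \<subseteq> D \<and> emeasure P D \<le> K * mdiam_powr s (U i)"
      by blast
    then obtain C where C: "\<And>i. C i \<in> sets P" "\<And>i. {y \<in> space P. \<Phi> y \<in> U i} \<subseteq> C i"
      "\<And>i. emeasure P (C i) \<le> K * mdiam_powr s (U i)"
      by metis
    have "space P \<subseteq> (\<Union>i. C i)" using \<Phi> U(1) C(2) by blast
    then have "1 \<le> emeasure P (\<Union>i. C i)"
      using C(1) prob_space.emeasure_space_1[OF P] emeasure_mono[of "space P" "\<Union>i. C i" P] by auto
    also have "\<dots> \<le> (\<Sum>i. emeasure P (C i))"
      using C(1) by (intro emeasure_subadditive_countably) auto
    also have "\<dots> \<le> (\<Sum>i. K * mdiam_powr s (U i))"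
      by (intro suminf_le C(3)) auto
    finally show ?thesis by simp
  qed
  have "1 / K \<le> hausdorff_premeasure s 1 A"
    unfolding hausdorff_premeasure_def
  proof (rule INF_greatest, clarsimp)
    fix U :: "nat \<Rightarrow> 'a set" assume "A \<subseteq> (\<Union>i. U i)" "\<forall>i. U i \<subseteq> M \<and> mdiam (U i) \<le> 1"
    then have le: "1 \<le> K * (\<Sum>i. mdiam_powr s (U i))" by (intro *) auto
    moreover have "K \<noteq> 0" using le by (intro notI) simp
    ultimately show "1 / K \<le> (\<Sum>i. mdiam_powr s (U i))"
      using K by (subst divide_le_posI_ennreal) (auto simp: zero_less_iff_neq_zero)
  qed
  also have "\<dots> \<le> hausdorff_measure s A"
    unfolding hausdorff_measure_def by (intro SUP_upper) auto
  finally show ?thesis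
    using K by (auto simp: ennreal_divide_eq_0_iff)
qed

end

section \<open>Cylinders and early returns\<close>

definition cylinder :: "nat \<Rightarrow> nat \<Rightarrow> (nat \<Rightarrow> nat) \<Rightarrow> (nat \<Rightarrow> nat) set" where
  "cylinder m n w = {x \<in> full_shift m. \<forall>i<n. x i = w i}"

lemma shift_dist_le:
  assumes "m \<ge> 1" "\<And>i. i < n \<Longrightarrow> x i = y i"
  shows "shift_dist m x y \<le> real m powr - real n"
proof (cases "x = y")
  case False
  then have "\<exists>k. x k \<noteq> y k" by auto
  then have "x (LEAST k. x k \<noteq> y k) \<noteq> y (LEAST k. x k \<noteq> y k)" by (rule LeastI_ex)
  then have "n \<le> (LEAST k. x k \<noteq> y k)" using assms(2) not_less by blast
  then show ?thesis using assms(1) False by (auto simp: shift_dist_def intro!: powr_mono)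
qed (simp add: shift_dist_def)

lemma mdiam_cylinder_le:
  assumes "m \<ge> 1"
  shows "shift_space.mdiam m (cylinder m n w) \<le> ennreal (real m powr - real n)"
  unfolding shift_space.mdiam_def
  by (intro SUP_least ennreal_leI shift_dist_le assms) (auto simp: cylinder_def)

lemma return_time_le_iff:
  "return_time n x \<le> enat h \<longleftrightarrow> (\<exists>j\<in>{1..h}. \<forall>i<n. x (j + i) = x i)" (is "?L \<longleftrightarrow> ?R")
proof
  assume ?L
  show ?R
  proof (rule ccontr)
    assume "\<not> ?R"
    then have "enat (Suc h) \<le> return_time n x"
      unfolding return_time_def by (intro INF_greatest) (auto simp: not_less_eq_eq)
    with \<open>?L\<close> show False by (metis enat_ord_simps(1) not_less_eq_eq order_refl order_trans)
  qed
next
  assume ?R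
  then show ?L unfolding return_time_def by (auto intro: INF_lower2)
qed

text \<open>Cylinders of length \<open>n\<close> have diameter at most \<open>m\<^sup>-\<^sup>n\<close>, so \<open>m\<^bsup>(s - q) n\<^esup>\<close> of them cost
at most \<open>m\<^bsup>-q n\<^esup>\<close>, a geometric series.\<close>

lemma hausdorff_measure_cylinders_eq_0:
  fixes W :: "nat \<Rightarrow> (nat \<Rightarrow> nat) set"
  assumes m: "m \<ge> 2" and s: "s > 0" and fin: "\<And>n. finite (W n)"
    and q: "0 < q" and card: "\<forall>\<^sub>F n in sequentially. real (card (W n)) \<le> real m powr ((s - q) * real n)"
    and cover: "\<And>x. x \<in> A \<Longrightarrow> \<exists>\<^sub>F n in sequentially. x \<in> (\<Union>w\<in>W n. cylinder m n w)"
  shows "shift_space.hausdorff_measure m s A = 0"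
proof (rule shift_space.hausdorff_measure_limsup_eq_0[where r = "\<lambda>n. real m powr - real n"
      and \<C> = "\<lambda>n. cylinder m n ` W n"])
  show "(\<lambda>n. real m powr - real n) \<longlonglongrightarrow> 0" using m by real_asymp
  have geom: "summable (\<lambda>n. (real m powr - q) ^ n)"
    using m q by (intro summable_geometric) (auto simp: powr_less_one)
  show "summable (\<lambda>n. real (card (cylinder m n ` W n)) * (real m powr - real n) powr s)"
  proof (rule summable_comparison_test_ev[OF _ geom])
    show "\<forall>\<^sub>F n in sequentially. norm (real (card (cylinder m n ` W n)) * (real m powr - real n) powr s)
        \<le> (real m powr - q) ^ n"
      using card
    proof eventually_elim
      case (elim n)
      have "real (card (cylinder m n ` W n)) \<le> real m powr ((s - q) * real n)"
        using card_image_le[OF fin, of "cylinder m n" n] elim by linarith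
      then have "real (card (cylinder m n ` W n)) * (real m powr - real n) powr s
          \<le> real m powr ((s - q) * real n) * (real m powr - real n) powr s"
        by (intro mult_right_mono) auto
      also have "\<dots> = (real m powr - q) powr real n"
        using m by (simp add: powr_powr powr_add[symmetric] algebra_simps)
      finally show ?case using m by (simp add: powr_realpow)
    qed
  qed
next
  show "U \<subseteq> full_shift m" if "U \<in> cylinder m n ` W n" for n U
    using that by (auto simp: cylinder_def)
  show "shift_space.mdiam m U \<le> ennreal (real m powr - real n)" if "U \<in> cylinder m n ` W n" for n U
    using that m by (auto intro: mdiam_cylinder_le)
qed (use assms in auto)

lemma hausdorff_measure_full_shift_eq_0:
  assumes m: "m \<ge> 2" and s: "s > 1"
  shows "shift_space.hausdorff_measure m s (full_shift m) = 0"
proof (rule hausdorff_measure_cylinders_eq_0[where W = "\<lambda>n. {..<n} \<rightarrow>\<^sub>E {..<m}" and q = "s - 1", OF m])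
  fix x assume "x \<in> full_shift m"
  then have "restrict x {..<n} \<in> {..<n} \<rightarrow>\<^sub>E {..<m}" "x \<in> cylinder m n (restrict x {..<n})" for n
    by (auto simp: full_shift_def cylinder_def)
  then have "x \<in> (\<Union>w\<in>{..<n} \<rightarrow>\<^sub>E {..<m}. cylinder m n w)" for n
    by (intro UN_I[of "restrict x {..<n}"])
  then show "\<exists>\<^sub>F n in sequentially. x \<in> (\<Union>w\<in>{..<n} \<rightarrow>\<^sub>E {..<m}. cylinder m n w)"
    by (simp add: frequently_sequentially) blast
qed (use s m in \<open>auto simp: card_PiE powr_realpow intro!: finite_PiE\<close>)

lemma hausdorff_dim_full_shift_le:
  assumes "m \<ge> 2" "A \<subseteq> full_shift m"
  shows "shift_space.hausdorff_dim m A \<le> 1"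
proof -
  have "shift_space.hausdorff_dim m (full_shift m) \<le> ereal 1"
    using hausdorff_measure_full_shift_eq_0[OF assms(1)]
    by (intro shift_space.hausdorff_dim_leI) auto
  with shift_space.hausdorff_dim_mono[OF assms(2)] show ?thesis
    by (metis one_ereal_def order_trans)
qed

text \<open>A return at time \<open>j \<le> h n\<close> forces \<open>x i = x (i mod j)\<close> for \<open>i < n\<close>. The initial word of length \<open>n\<close> is
therefore determined by \<open>j\<close> and the first \<open>h n\<close> symbols, which leaves at most
\<open>h n * m ^ h n \<le> m ^ (2 * h n)\<close> words, and \<open>2 * h n\<close> is eventually smaller than \<open>s / 2 * n\<close>.\<close>

lemma hausdorff_dim_early_return_eq_0:
  fixes h :: "nat \<Rightarrow> nat"
  assumes m: "m \<ge> 2" and h: "(\<lambda>n. real (h n) / real n) \<longlonglongrightarrow> 0" and A: "A \<subseteq> full_shift m"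
    and early: "\<And>x. x \<in> A \<Longrightarrow> \<exists>\<^sub>F n in sequentially. return_time n x \<le> enat (h n)"
  shows "shift_space.hausdorff_dim m A = 0"
proof -
  have "shift_space.hausdorff_measure m s A = 0" if s: "s > 0" for s :: real
  proof (rule hausdorff_measure_cylinders_eq_0[OF m s, where q = "s / 2" and
        W = "\<lambda>n. (\<lambda>(j, w) i. w (i mod j)) ` ({1..h n} \<times> ({..<h n} \<rightarrow>\<^sub>E {..<m}))"])
    show "finite ((\<lambda>(j, w) i. w (i mod j)) ` ({1..h n} \<times> ({..<h n} \<rightarrow>\<^sub>E {..<m})))" for n
      by (intro finite_imageI finite_cartesian_product finite_PiE) auto
    have "\<forall>\<^sub>F n in sequentially. real (h n) / real n < s / 4"
      using h s by (intro order_tendstoD) auto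
    then show "\<forall>\<^sub>F n in sequentially.
        real (card ((\<lambda>(j, w) i. w (i mod j)) ` ({1..h n} \<times> ({..<h n} \<rightarrow>\<^sub>E {..<m}))))
          \<le> real m powr ((s - s / 2) * real n)"
      using eventually_gt_at_top[of 0]
    proof eventually_elim
      case (elim n)
      let ?S = "{1..h n} \<times> ({..<h n} \<rightarrow>\<^sub>E {..<m})"
      have "card ((\<lambda>(j, w) i. w (i mod j)) ` ?S) \<le> card ?S"
        by (intro card_image_le finite_cartesian_product finite_PiE) auto
      also have "\<dots> = h n * m ^ h n" by (simp add: card_cartesian_product card_PiE)
      also have "\<dots> \<le> m ^ h n * m ^ h n"
        using less_exp[of "h n"] power_mono[OF m, of "h n"] by (intro mult_right_mono) linarith+
      finally have "real (card ((\<lambda>(j, w) i. w (i mod j)) ` ?S)) \<le> real (m ^ (2 * h n))"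
        by (simp only: power_add[symmetric] mult_2 of_nat_le_iff)
      also have "\<dots> = real m powr (2 * real (h n))"
        using m powr_realpow[of "real m" "2 * h n"] by simp
      also have "\<dots> \<le> real m powr ((s - s / 2) * real n)"
        using elim m by (intro powr_mono) (auto simp: field_simps)
      finally show ?case .
    qed
    fix x assume x: "x \<in> A"
    show "\<exists>\<^sub>F n in sequentially. x \<in> (\<Union>w\<in>(\<lambda>(j, w) i. w (i mod j)) ` ({1..h n} \<times> ({..<h n} \<rightarrow>\<^sub>E {..<m})).
        cylinder m n w)"
      using early[OF x]
    proof (rule frequently_elim1)
      fix n assume "return_time n x \<le> enat (h n)"
      then obtain j where j: "j \<in> {1..h n}" "\<And>i. i < n \<Longrightarrow> x (j + i) = x i"
        unfolding return_time_le_iff by blast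
      have per: "x i = x (i mod j)" if "i < n" for i
        using that
      proof (induction i rule: less_induct)
        case (less i)
        show ?case
        proof (cases "i < j")
          case False
          then have "x i = x (i - j)" using j(2)[of "i - j"] less.prems by simp
          then show ?thesis using less.IH[of "i - j"] less.prems False j(1) by (simp add: le_mod_geq)
        qed simp
      qed
      have "i mod j < h n" for i
        using j(1) by (meson atLeastAtMost_iff less_le_trans mod_less_divisor zero_less_one)
      then have "x \<in> cylinder m n ((\<lambda>(j, w) i. w (i mod j)) (j, restrict x {..<h n}))"
        using per x A by (auto simp: cylinder_def)
      moreover have "restrict x {..<h n} \<in> {..<h n} \<rightarrow>\<^sub>E {..<m}"
        using x A by (auto simp: full_shift_def)
      with j(1) have "(j, restrict x {..<h n}) \<in> {1..h n} \<times> ({..<h n} \<rightarrow>\<^sub>E {..<m})"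
        by (rule SigmaI)
      ultimately show "x \<in> (\<Union>w\<in>(\<lambda>(j, w) i. w (i mod j)) ` ({1..h n} \<times> ({..<h n} \<rightarrow>\<^sub>E {..<m})).
          cylinder m n w)"
        by (intro UN_I[OF imageI])
    qed
  qed (use s in auto)
  then have "shift_space.hausdorff_dim m A \<le> ereal 0"
    by (intro shift_space.hausdorff_dim_leI) auto
  with shift_space.hausdorff_dim_nonneg[of m A] show ?thesis by (metis zero_ereal_def antisym)
qed

section \<open>Mass distribution along free coordinates\<close>

lemma shift_dist_ge:
  assumes "m \<ge> 1" "x k \<noteq> y k"
  shows "real m powr - real k \<le> shift_dist m x y"
proof -
  have "(LEAST k. x k \<noteq> y k) \<le> k" using assms(2) by (rule Least_le)
  moreover have "x \<noteq> y" using assms(2) by auto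
  ultimately show ?thesis using assms(1) by (auto simp: shift_dist_def intro!: powr_mono)
qed

lemma mdiam_powr_shift_ge:
  assumes "m \<ge> 1" "x \<in> U" "y \<in> U" "x k \<noteq> y k" "s > 0"
  shows "ennreal (real m powr - (s * real k)) \<le> shift_space.mdiam_powr m s U"
proof -
  have "ennreal (real m powr - real k) \<le> ennreal (shift_dist m x y)"
    using shift_dist_ge[of m x k y] assms by (intro ennreal_leI) auto
  also have "\<dots> \<le> shift_space.mdiam m U"
    unfolding shift_space.mdiam_def using assms by (intro SUP_upper2[of x] SUP_upper2[of y]) auto
  finally have le: "ennreal (real m powr - real k) \<le> shift_space.mdiam m U" .
  have "shift_space.mdiam m U \<le> ennreal 1"
    unfolding shift_space.mdiam_def
    using shift_dist_le[of m 0] assms(1) by (intro SUP_least ennreal_leI) auto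
  then have "shift_space.mdiam m U < top"
    by (rule order_le_less_trans) simp
  from enn2real_mono[OF le this] have "real m powr - real k \<le> enn2real (shift_space.mdiam m U)"
    by simp
  then have "(real m powr - real k) powr s \<le> enn2real (shift_space.mdiam m U) powr s"
    using assms(5) by (intro powr_mono2) auto
  moreover have "(real m powr - real k) powr s = real m powr - (s * real k)"
    by (simp add: powr_powr mult.commute)
  ultimately show ?thesis
    using assms by (auto simp: shift_space.mdiam_powr_def intro!: ennreal_leI)
qed

definition uniform_bernoulli :: "nat \<Rightarrow> (nat \<Rightarrow> nat) measure" where
  "uniform_bernoulli m = Pi\<^sub>M UNIV (\<lambda>_. uniform_count_measure {..<m})"

lemma space_uniform_bernoulli: "space (uniform_bernoulli m) = full_shift m"
  by (auto simp: uniform_bernoulli_def space_PiM space_uniform_count_measure full_shift_def)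

lemma prob_space_uniform_bernoulli: "m \<ge> 1 \<Longrightarrow> prob_space (uniform_bernoulli m)"
  unfolding uniform_bernoulli_def
  by (intro prob_space_PiM prob_space_uniform_count_measure) (auto simp: lessThan_empty_iff)

lemma uniform_bernoulli_prescribed:
  assumes m: "m \<ge> 1" and w: "w \<in> full_shift m" and J: "finite J"
  shows "{y \<in> full_shift m. \<forall>i\<in>J. y i = w i} \<in> sets (uniform_bernoulli m)"
    and "emeasure (uniform_bernoulli m) {y \<in> full_shift m. \<forall>i\<in>J. y i = w i} = ennreal (real m powr - real (card J))"
proof -
  interpret product_prob_space "\<lambda>_. uniform_count_measure {..<m}" UNIV
    using m by (intro product_prob_spaceI prob_space_uniform_count_measure) (auto simp: lessThan_empty_iff)
  have eq: "{y \<in> full_shift m. \<forall>i\<in>J. y i = w i} = {y \<in> space (uniform_bernoulli m). \<forall>i\<in>J. y i \<in> {w i}}"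
    by (simp add: space_uniform_bernoulli)
  have sets: "{w i} \<in> sets (uniform_count_measure {..<m})" for i
    using w by (auto simp: sets_uniform_count_measure full_shift_def)
  have "emeasure (uniform_bernoulli m) {y \<in> full_shift m. \<forall>i\<in>J. y i = w i}
      = (\<Prod>i\<in>J. emeasure (uniform_count_measure {..<m}) {w i})"
    unfolding eq uniform_bernoulli_def using sets J by (intro emeasure_PiM_Collect) auto
  also have "\<dots> = (\<Prod>i\<in>J. ennreal (real m powr - 1))"
    using w m
    by (intro prod.cong refl, subst emeasure_uniform_count_measure)
      (auto simp: full_shift_def powr_minus divide_inverse)
  also have "\<dots> = ennreal (real m powr - real (card J))"
    using m by (simp add: ennreal_power powr_minus powr_realpow power_one_over divide_inverse power_inverse)
  finally show "emeasure (uniform_bernoulli m) {y \<in> full_shift m. \<forall>i\<in>J. y i = w i} = \<dots>" .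
  show "{y \<in> full_shift m. \<forall>i\<in>J. y i = w i} \<in> sets (uniform_bernoulli m)"
    unfolding eq uniform_bernoulli_def using sets J by (intro sets.sets_Collect_finite_All sets_Collect_single) auto
qed

text \<open>If a point of \<open>A\<close> can be found for any prescribed symbols at the positions in \<open>F\<close>, then \<open>A\<close> carries
a mass for which a cylinder of length \<open>n\<close> weighs at most \<open>m\<^bsup>-card (F \<inter> {..<n})\<^esup>\<close>. The
density bound turns this into at most \<open>m\<^sup>c\<close> times the \<open>s\<close>-th power of the diameter.\<close>

lemma hausdorff_measure_neq_0_of_free_coordinates:
  assumes m: "m \<ge> 2" and \<Phi>: "\<And>y. y \<in> full_shift m \<Longrightarrow> \<Phi> y \<in> A"
    and free: "\<And>y i. y \<in> full_shift m \<Longrightarrow> i \<in> F \<Longrightarrow> \<Phi> y i = y i"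
    and s: "0 \<le> s" and dens: "\<And>n. s * real n - c \<le> real (card (F \<inter> {..<n}))"
  shows "shift_space.hausdorff_measure m s A \<noteq> 0"
proof (rule shift_space.hausdorff_measure_neq_0I[where P = "uniform_bernoulli m" and \<Phi> = \<Phi>
      and K = "ennreal (real m powr c)"])
  show "prob_space (uniform_bernoulli m)" using m by (intro prob_space_uniform_bernoulli) simp
  interpret B: prob_space "uniform_bernoulli m" by fact
  show "\<Phi> y \<in> A" if "y \<in> space (uniform_bernoulli m)" for y using that \<Phi> by (simp add: space_uniform_bernoulli)
  show "ennreal (real m powr c) < \<infinity>" by simp
  fix U assume U: "U \<subseteq> full_shift m"
  let ?good = "\<lambda>D. D \<in> sets (uniform_bernoulli m) \<and> {y \<in> space (uniform_bernoulli m). \<Phi> y \<in> U} \<subseteq> D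
    \<and> emeasure (uniform_bernoulli m) D \<le> ennreal (real m powr c) * shift_space.mdiam_powr m s U"
  consider "U = {}" | "U \<noteq> {}" "s = 0" | u where "u \<in> U" "s > 0" using s by force
  then have "\<exists>D. ?good D"
  proof cases
    case 1
    then have "?good {}" by simp
    then show ?thesis by blast
  next
    case 2
    have "- c \<le> 0" using dens[of 0] 2 by simp
    then have "1 \<le> real m powr c" using m by (intro ge_one_powr_ge_zero) auto
    then have "ennreal 1 \<le> ennreal (real m powr c)" by (intro ennreal_leI)
    then have "?good (space (uniform_bernoulli m))"
      using 2 B.emeasure_space_1 by (auto simp: shift_space.mdiam_powr_def)
    then show ?thesis by blast
  next
    case (3 u)
    then have u: "u \<in> full_shift m" using U by auto
    \<comment> \<open>The mass of the cylinder of length \<open>n\<close> around \<open>u\<close>.\<close>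
    define D where "D n = {y \<in> full_shift m. \<forall>i\<in>F \<inter> {..<n}. y i = u i}" for n
    have D_sets: "D n \<in> sets (uniform_bernoulli m)" for n
      unfolding D_def using m u by (intro uniform_bernoulli_prescribed) auto
    have D_meas: "emeasure (uniform_bernoulli m) (D n) \<le> ennreal (real m powr c) * ennreal (real m powr - (s * real n))" for n
    proof -
      have "emeasure (uniform_bernoulli m) (D n) = ennreal (real m powr - real (card (F \<inter> {..<n})))"
        unfolding D_def using m u by (intro uniform_bernoulli_prescribed) auto
      also have "\<dots> \<le> ennreal (real m powr (c + - (s * real n)))"
        using dens[of n] m by (intro ennreal_leI powr_mono) auto
      finally show ?thesis using m by (simp only: powr_add ennreal_mult' powr_ge_zero)
    qed
    have D_cover: "{y \<in> space (uniform_bernoulli m). \<Phi> y \<in> U} \<subseteq> D n" if "\<forall>x\<in>U. \<forall>i<n. x i = u i" for n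
      using that by (auto simp: D_def space_uniform_bernoulli free)
    show ?thesis
    proof (cases "\<exists>k. \<exists>x\<in>U. x k \<noteq> u k")
      case True
      \<comment> \<open>\<open>U\<close> lies in a cylinder of length \<open>k\<close>, and its diameter is at least \<open>m\<^sup>-\<^sup>k\<close>.\<close>
      define k where "k = (LEAST k. \<exists>x\<in>U. x k \<noteq> u k)"
      obtain x where x: "x \<in> U" "x k \<noteq> u k" using LeastI_ex[OF True] unfolding k_def by blast
      have "\<forall>x\<in>U. \<forall>i<k. x i = u i" unfolding k_def using not_less_Least by blast
      moreover have "ennreal (real m powr c) * ennreal (real m powr - (s * real k))
          \<le> ennreal (real m powr c) * shift_space.mdiam_powr m s U"
        using m x 3 by (intro mult_left_mono mdiam_powr_shift_ge[of m x U u]) auto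
      ultimately have "?good (D k)"
        using D_sets D_cover D_meas[of k] order_trans by blast
      then show ?thesis by blast
    next
      case False
      \<comment> \<open>A singleton has cost \<open>0\<close>, and as \<open>F\<close> is infinite its mass is \<open>0\<close> too.\<close>
      let ?I = "\<Inter>n. D n"
      have "?I \<in> sets (uniform_bernoulli m)" using D_sets by auto
      moreover have "{y \<in> space (uniform_bernoulli m). \<Phi> y \<in> U} \<subseteq> ?I"
        using False D_cover by (intro INT_greatest) blast
      moreover have "emeasure (uniform_bernoulli m) ?I = 0"
      proof -
        have le: "measure (uniform_bernoulli m) ?I \<le> real m powr c * real m powr - (s * real n)" for n
        proof -
          have "emeasure (uniform_bernoulli m) ?I \<le> emeasure (uniform_bernoulli m) (D n)"
            using D_sets by (intro emeasure_mono) auto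
          also note D_meas
          finally have "ennreal (measure (uniform_bernoulli m) ?I) \<le> ennreal (real m powr c * real m powr - (s * real n))"
            by (simp add: B.emeasure_eq_measure ennreal_mult')
          then show ?thesis by (subst (asm) ennreal_le_iff) auto
        qed
        have "(\<lambda>n. real m powr c * real m powr - (s * real n)) \<longlonglongrightarrow> 0"
          using m \<open>s > 0\<close> by real_asymp
        then have "measure (uniform_bernoulli m) ?I \<le> 0"
          by (rule LIMSEQ_le_const) (use le in blast)
        then have "measure (uniform_bernoulli m) ?I = 0" by (intro antisym measure_nonneg)
        then show ?thesis by (simp add: B.emeasure_eq_measure)
      qed
      ultimately have "?good ?I" by simp
      then show ?thesis by blast
    qed
  qed
  then show "\<exists>D\<in>sets (uniform_bernoulli m). {y \<in> space (uniform_bernoulli m). \<Phi> y \<in> U} \<subseteq> D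
    \<and> emeasure (uniform_bernoulli m) D \<le> ennreal (real m powr c) * shift_space.mdiam_powr m s U"
    by blast
qed

section \<open>Sequences with prescribed return times\<close>

text \<open>The sequence with free symbols \<open>y\<close>. It starts with \<open>0\<^sup>N 1\<close>. For every \<open>k \<ge> k0\<close> the interval
from \<open>2^k - 1\<close> to \<open>2^k + 2 * l k\<close> (the zone of \<open>k\<close>) holds, in this order, a separator \<open>1\<close>, a copy of the
first \<open>l k\<close> symbols, one symbol that differs from the next symbol of the original, and \<open>l k\<close>
ones. The zone of \<open>k\<close> starts where \<open>Suc i = 2^k\<close> and, for sparse \<open>l\<close>, ends before the next one starts;
hence \<open>floor_log (Suc i)\<close> is the only candidate for the zone of \<open>i\<close>.\<close>

function copying :: "nat \<Rightarrow> nat \<Rightarrow> (nat \<Rightarrow> nat) \<Rightarrow> (nat \<Rightarrow> nat) \<Rightarrow> nat \<Rightarrow> nat" where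
  "copying N k0 l y i =
    (if i < N then 0 else if i = N then 1 else
     let k = floor_log (Suc i) in
       if k < k0 \<or> 2 ^ k + 2 * l k < i then (if N dvd i then 1 else y i)
       else if i < 2 ^ k then 1
       else if i < 2 ^ k + l k then copying N k0 l y (i - 2 ^ k)
       else if i = 2 ^ k + l k then (if copying N k0 l y (l k) = 0 then 1 else 0)
       else 1)"
  by pat_completeness auto
termination
proof (relation "Wellfounded.measure (\<lambda>(N, k0, l, y, i). i)", goal_cases)
  case (2 N k0 l y i k)
  then have "0 < i" by linarith
  then show ?case by simp
next
  case (3 N k0 l y i k)
  have "(0::nat) < 2 ^ k" by simp
  with 3(7) have "l k < i" by linarith
  then show ?case by simp
qed simp

declare copying.simps [simp del]

text \<open>The first condition on \<open>l\<close> puts the whole marker \<open>0\<^sup>N 1\<close> into every copy; the second makes the zones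
disjoint and of total length at most \<open>n / N\<close> below \<open>n\<close>.\<close>

locale copy_schedule =
  fixes N k0 :: nat and l :: "nat \<Rightarrow> nat"
  assumes N: "2 \<le> N" and long: "\<And>k. k0 \<le> k \<Longrightarrow> N < l k"
    and sparse: "\<And>k. k0 \<le> k \<Longrightarrow> 8 * N * l k \<le> 2 ^ k"
begin

lemma sparse4: "k0 \<le> k \<Longrightarrow> 4 * l k \<le> 2 ^ k"
proof -
  assume "k0 \<le> k"
  have "4 * l k \<le> 8 * N * l k" using N by simp
  also note sparse[OF \<open>k0 \<le> k\<close>]
  finally show ?thesis .
qed

lemma floor_log_zone:
  assumes "k0 \<le> k" "2 ^ k \<le> Suc i" "i \<le> 2 ^ k + 2 * l k"
  shows "floor_log (Suc i) = k" "N < i"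
proof -
  have "4 * l k \<le> 2 ^ k" "N < l k" using assms sparse4 long by auto
  then show "floor_log (Suc i) = k" "N < i"
    using assms N by (auto intro!: floor_log_eqI)
qed

lemma copying_prefix: "i < N \<Longrightarrow> copying N k0 l y i = 0" "copying N k0 l y N = 1"
  by (simp_all add: copying.simps[of N k0 l y i] copying.simps[of N k0 l y N])

lemma copying_before: "k0 \<le> k \<Longrightarrow> copying N k0 l y (2 ^ k - 1) = 1"
  using floor_log_zone[of k "2 ^ k - 1"]
  by (simp add: copying.simps[of N k0 l y "2 ^ k - Suc 0"] trans_le_add1)

lemma copying_copy: "k0 \<le> k \<Longrightarrow> t < l k \<Longrightarrow> copying N k0 l y (2 ^ k + t) = copying N k0 l y t"
  using floor_log_zone[of k "2 ^ k + t"] by (auto simp: copying.simps[of N k0 l y "2 ^ k + t"])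

lemma copying_end: "k0 \<le> k \<Longrightarrow> copying N k0 l y (2 ^ k + l k) \<noteq> copying N k0 l y (l k)"
  using floor_log_zone[of k "2 ^ k + l k"] by (auto simp: copying.simps[of N k0 l y "2 ^ k + l k"])

lemma copying_ones: "k0 \<le> k \<Longrightarrow> 1 \<le> t \<Longrightarrow> t \<le> l k \<Longrightarrow> copying N k0 l y (2 ^ k + l k + t) = 1"
  using floor_log_zone[of k "2 ^ k + l k + t"] by (auto simp: copying.simps[of N k0 l y "2 ^ k + l k + t"])

lemma copying_dvd:
  assumes "N < i" "N dvd i" "copying N k0 l y i \<noteq> 1"
  obtains k where "k0 \<le> k" "2 ^ k \<le> i" "i \<le> 2 ^ k + l k"
  using assms that[of "floor_log (Suc i)"]
  by (auto simp: copying.simps[of N k0 l y i] Let_def not_less split: if_splits)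

definition free :: "nat set" where
  "free = {i. N < i \<and> \<not> N dvd i \<and> (\<forall>k\<ge>k0. 2 ^ k \<le> Suc i \<longrightarrow> 2 ^ k + 2 * l k < i)}"

lemma copying_free: "i \<in> free \<Longrightarrow> copying N k0 l y i = y i"
  using floor_log_exp2_le[of "Suc i"]
  by (auto simp: free_def copying.simps[of N k0 l y i] Let_def not_less)

lemma copying_in_full_shift:
  assumes "y \<in> full_shift m" "m \<ge> 2"
  shows "copying N k0 l y \<in> full_shift m"
proof -
  have "copying N k0 l y i < m" for i
  proof (induction i rule: less_induct)
    case (less i)
    show ?case
      using less.IH[of "i - 2 ^ floor_log (Suc i)"] assms N
      by (auto simp: copying.simps[of N k0 l y i] Let_def full_shift_def)
  qed
  then show ?thesis by (simp add: full_shift_def)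
qed

text \<open>A match of length at least \<open>N\<close> shows the block \<open>0\<^sup>N\<close> at \<open>p\<close>, and one position of this block is a
multiple of \<open>N\<close>. As it carries a \<open>0\<close>, it belongs to a copy or to the symbol that follows the copy. The \<open>1\<close>
before the copy and the ones behind that symbol confine the start \<open>p\<close> to the copy, say \<open>p = 2^k + q\<close> with \<open>q < l k\<close>. Suppose the match
were longer than \<open>l k\<close>. For \<open>q = 0\<close> it would include the breaking symbol. For \<open>q > 0\<close> the
overlap of the match with the copy makes the first \<open>l k\<close> symbols \<open>q\<close>-periodic, while the ones after the copy
make the last \<open>q - 1\<close> of them equal to \<open>1\<close>. For \<open>q \<ge> 2\<close> one of the residues \<open>0\<close> and \<open>1\<close>
modulo \<open>q\<close> occurs among these last positions, so that \<open>x 0\<close> or \<open>x 1\<close> would be \<open>1\<close>; for \<open>q = 1\<close> the symbols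
\<open>x 0 = 0\<close> and \<open>x N = 1\<close> would agree.\<close>

lemma copying_recurrence:
  fixes y
  defines "x \<equiv> copying N k0 l y"
  assumes p: "0 < p" and n: "N \<le> n" and match: "\<And>i. i < n \<Longrightarrow> x (p + i) = x i"
  obtains k where "k0 \<le> k" "n \<le> l k" "2 ^ k \<le> p"
proof -
  have x0: "x i = 0" if "i < N" for i using that copying_prefix by (simp add: x_def)
  have xN: "x N = 1" using copying_prefix by (simp add: x_def)
  \<comment> \<open>The least multiple of \<open>N\<close> that is at least \<open>p\<close>.\<close>
  define i where "i = N * ((p + N - 1) div N)"
  have i: "p \<le> i" "i < p + N"
  proof -
    have "(p + N - 1) mod N < N" "i + (p + N - 1) mod N = p + N - 1"
      using N by (simp_all add: i_def)
    then show "p \<le> i" "i < p + N" using p N by linarith+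
  qed
  have xi: "x i = 0"
    using match[of "i - p"] i n x0[of "i - p"] by simp
  have "N dvd i" by (simp add: i_def)
  moreover have "N \<noteq> i" using xi xN by auto
  moreover have "N \<le> i" using \<open>N dvd i\<close> i p by (intro dvd_imp_le) auto
  ultimately obtain k where k: "k0 \<le> k" "2 ^ k \<le> i" "i \<le> 2 ^ k + l k"
    using copying_dvd[of i y] xi by (auto simp: x_def)
  have "2 ^ k \<le> p"
  proof (rule ccontr)
    assume "\<not> 2 ^ k \<le> p"
    then have "x (2 ^ k - 1) = x (2 ^ k - 1 - p)" "2 ^ k - 1 - p < N"
      using match[of "2 ^ k - 1 - p"] k i n by auto
    then show False using x0 copying_before[OF k(1), of y] by (simp add: x_def)
  qed
  moreover have "n \<le> l k"
  proof (rule ccontr)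
    assume "\<not> n \<le> l k"
    then have nl: "l k < n" by simp
    have lN: "N < l k" using long k by blast
    have "p \<noteq> 2 ^ k + l k"
    proof
      assume "p = 2 ^ k + l k"
      then have "x (p + 1) = 1" using copying_ones[OF k(1), of 1 y] lN by (simp add: x_def)
      then show False using match[of 1] x0[of 1] N n by simp
    qed
    define q where "q = p - 2 ^ k"
    have p_eq: "p = 2 ^ k + q" and q: "q < l k"
      using \<open>2 ^ k \<le> p\<close> \<open>p \<noteq> 2 ^ k + l k\<close> k i by (auto simp: q_def)
    have per: "x (t + q) = x t" if "t + q < l k" for t
      using match[of t] copying_copy[OF k(1) that, of y] that nl p_eq by (simp add: x_def add_ac)
    have ones: "x s = 1" if "l k < s + q" "s \<le> l k" for s
    proof -
      have "x (2 ^ k + l k + (s + q - l k)) = 1"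
        unfolding x_def using that q by (intro copying_ones[OF k(1)]) auto
      then show ?thesis using match[of s] that nl p_eq by (simp add: add_ac)
    qed
    have per': "x (r + q * c) = x r" if "r + q * c < l k" for r c
      using that
    proof (induction c)
      case (Suc c)
      then show ?case using per[of "r + q * c"] by (simp add: algebra_simps)
    qed simp
    consider "q = 0" | "q = 1" | "2 \<le> q" by linarith
    then show False
    proof cases
      case 1
      then show False
        using match[OF nl] copying_end[OF k(1), of y] p_eq by (simp add: x_def)
    next
      case 2
      then show False using per'[of 0 N] lN x0[of 0] xN N by simp
    next
      case 3
      \<comment> \<open>The window of the \<open>q - 1\<close> positions from \<open>s0\<close> to \<open>l k - 1\<close>; unless \<open>s0\<close> itself serves,
        the next multiple of \<open>q\<close> is still inside.\<close>
      define s0 where "s0 = Suc (l k) - q"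
      obtain s where s: "l k < s + q" "s < l k" "s mod q < 2"
      proof (cases "s0 mod q < 2")
        case True
        then show ?thesis using that[of s0] 3 q by (auto simp: s0_def)
      next
        case False
        define r where "r = s0 mod q"
        have r: "2 \<le> r" "r < q" using False 3 by (simp_all add: r_def)
        have "s0 + (q - r) = q * (s0 div q + 1)"
          using r div_mult_mod_eq[of s0 q] unfolding r_def[symmetric] by (simp add: algebra_simps)
        then have "(s0 + (q - r)) mod q < 2" by simp
        moreover have "l k < s0 + (q - r) + q" "s0 + (q - r) < l k"
          using r q by (simp_all add: s0_def)
        ultimately show ?thesis using that by blast
      qed
      have "x s = x (s mod q)"
        using per'[of "s mod q" "s div q"] s(2) by simp
      also have "\<dots> = 0" using s(3) N x0 by simp
      finally show False using ones[of s] s by simp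
    qed
  qed
  ultimately show thesis using that k by blast
qed

lemma return_time_copying:
  assumes n: "N \<le> n" and k: "k0 \<le> k" "n \<le> l k" and least: "\<And>k'. k' < k \<Longrightarrow> l k' < n"
  shows "return_time n (copying N k0 l y) = enat (2 ^ k)"
proof (rule antisym)
  show "return_time n (copying N k0 l y) \<le> enat (2 ^ k)"
    unfolding return_time_le_iff using copying_copy k by (intro bexI[of _ "2 ^ k"]) auto
  show "enat (2 ^ k) \<le> return_time n (copying N k0 l y)"
    unfolding return_time_def
  proof (intro INF_greatest, clarsimp)
    fix j assume j: "Suc 0 \<le> j" "\<forall>i<n. copying N k0 l y (j + i) = copying N k0 l y i"
    then obtain k' where k': "k0 \<le> k'" "n \<le> l k'" "2 ^ k' \<le> j"
      using copying_recurrence[of j n y] n by auto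
    then have "k \<le> k'" using least[of k'] by force
    then have "(2::nat) ^ k \<le> 2 ^ k'" by simp
    with k' show "2 ^ k \<le> j" by linarith
  qed
qed

lemma card_zones_le:
  "N * card {i. i < n \<and> (\<exists>k\<ge>k0. 2 ^ k \<le> Suc i \<and> i \<le> 2 ^ k + 2 * l k)} \<le> n" (is "N * card ?Z \<le> n")
proof (cases "n = 0")
  case False
  define L where "L = floor_log n"
  have L: "2 ^ L \<le> n" using False by (simp add: L_def floor_log_exp2_le)
  have "?Z \<subseteq> (\<Union>k\<in>{k0..L}. {2 ^ k - 1..2 ^ k + 2 * l k})"
  proof
    fix i assume "i \<in> ?Z"
    then obtain k where k: "i < n" "k0 \<le> k" "2 ^ k \<le> Suc i" "i \<le> 2 ^ k + 2 * l k" by auto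
    then have "2 ^ k \<le> n" by simp
    then have "k \<le> L" using floor_log_le_iff[of "2 ^ k" n] by (simp add: L_def)
    with k show "i \<in> (\<Union>k\<in>{k0..L}. {2 ^ k - 1..2 ^ k + 2 * l k})" by (intro UN_I[of k]) auto
  qed
  then have "card ?Z \<le> card (\<Union>k\<in>{k0..L}. {2 ^ k - 1..2 ^ k + 2 * l k})"
    by (intro card_mono) auto
  also have "\<dots> \<le> (\<Sum>k\<in>{k0..L}. card {2 ^ k - 1..2 ^ k + 2 * l k})"
    by (intro card_UN_le) auto
  also have "\<dots> \<le> (\<Sum>k\<in>{k0..L}. 4 * l k)"
  proof (intro sum_mono)
    fix k assume "k \<in> {k0..L}"
    then have "N < l k" using long by simp
    then show "card {2 ^ k - 1..2 ^ k + 2 * l k} \<le> 4 * l k" using N by simp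
  qed
  finally have "2 * (N * card ?Z) \<le> (\<Sum>k\<in>{k0..L}. 8 * N * l k)"
    by (simp add: sum_distrib_left[symmetric])
  also have "\<dots> \<le> (\<Sum>k\<in>{k0..L}. 2 ^ k)" using sparse by (intro sum_mono) auto
  also have "\<dots> \<le> (\<Sum>k<Suc L. 2 ^ k)" by (intro sum_mono2) auto
  also have "\<dots> \<le> 2 * 2 ^ L" by (simp only: lessThan_atLeast0 sum_power2 power_Suc)
  finally show ?thesis using L by linarith
qed simp

lemma card_free_ge:
  "real n * (1 - 2 / real N) - (real N + 2) \<le> real (card (free \<inter> {..<n}))"
proof -
  let ?Z = "{i. i < n \<and> (\<exists>k\<ge>k0. 2 ^ k \<le> Suc i \<and> i \<le> 2 ^ k + 2 * l k)}"
  let ?D = "(\<lambda>j. N * j) ` {..n div N}"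
  have "{..<n} \<subseteq> (free \<inter> {..<n}) \<union> ({..N} \<union> (?D \<union> ?Z))"
  proof
    fix i assume i: "i \<in> {..<n}"
    then have "i \<in> ?D" if "N dvd i"
      using that N by (intro image_eqI[of _ _ "i div N"]) (auto intro: div_le_mono)
    then show "i \<in> (free \<inter> {..<n}) \<union> ({..N} \<union> (?D \<union> ?Z))"
      using i by (auto simp: free_def not_less)
  qed
  then have "card {..<n} \<le> card ((free \<inter> {..<n}) \<union> ({..N} \<union> (?D \<union> ?Z)))"
    by (rule card_mono[rotated]) simp
  also have "\<dots> \<le> card (free \<inter> {..<n}) + (card {..N} + (card ?D + card ?Z))"
    using card_Un_le[of "free \<inter> {..<n}" "{..N} \<union> (?D \<union> ?Z)"] card_Un_le[of "{..N}" "?D \<union> ?Z"]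
      card_Un_le[of ?D ?Z] by linarith
  finally have "n \<le> card (free \<inter> {..<n}) + (N + 1 + (card ?D + card ?Z))" by simp
  moreover have "card ?D \<le> n div N + 1"
    using card_image_le[of "{..n div N}" "\<lambda>j. N * j"] by simp
  ultimately have "real n \<le> real (card (free \<inter> {..<n})) + (N + 2) + real (n div N) + real (card ?Z)"
    by linarith
  moreover have "real (n div N) \<le> real n / real N" by (rule of_nat_div_le_of_nat)
  moreover have "real (card ?Z) \<le> real n / real N"
  proof -
    have "real (N * card ?Z) \<le> real n" using card_zones_le[of n] by (simp only: of_nat_le_iff)
    then show ?thesis using N by (simp add: pos_le_divide_eq mult.commute)
  qed
  ultimately have "real n \<le> real (card (free \<inter> {..<n})) + (N + 2) + real n / real N + real n / real N"
    by linarith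
  then show ?thesis by (simp add: algebra_simps)
qed

end

text \<open>Positions \<open>2^k\<close> and copy lengths \<open>l k = max {n. \<kappa> n \<le> k}\<close> are chosen so that a word of length \<open>n\<close>
fits into the copy at \<open>2^k\<close> exactly when \<open>k \<ge> \<kappa> n\<close>. For a given \<open>s < 1\<close> the spacing \<open>N\<close> of the
forced ones is taken so large that the density \<open>1 - 2 / N\<close> of the free positions is at least \<open>s\<close>; the
copies start at a \<open>k0\<close> depending on \<open>N\<close>, which affects only finitely many return times.\<close>

theorem hausdorff_dim_prescribed_return_times:
  fixes \<kappa> :: "nat \<Rightarrow> nat"
  assumes m: "m \<ge> 2" and mono: "mono_on {1..} \<kappa>" and lim: "(\<lambda>n. real n / 2 ^ \<kappa> n) \<longlonglongrightarrow> 0"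
  shows "1 \<le> shift_space.hausdorff_dim m
    {x \<in> full_shift m. \<forall>\<^sub>F n in sequentially. return_time n x = enat (2 ^ \<kappa> n)}" (is "_ \<le> shift_space.hausdorff_dim m ?E")
proof -
  have "shift_space.hausdorff_measure m s ?E \<noteq> 0" if s: "0 \<le> s" "s < 1" for s :: real
  proof -
    obtain N :: nat where N_ge: "2 \<le> N" "2 / real N \<le> 1 - s"
    proof -
      obtain N0 :: nat where "2 / (1 - s) < real N0" using reals_Archimedean2 by blast
      then have "2 / real (N0 + 2) \<le> 1 - s" using s by (simp add: field_simps)
      with that[of "N0 + 2"] show thesis by simp
    qed
    have "\<forall>\<^sub>F n in sequentially. real n / 2 ^ \<kappa> n < 1 / (8 * real N)"
      using lim N_ge by (intro order_tendstoD) auto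
    then obtain n1 where n1: "\<And>n. n \<ge> n1 \<Longrightarrow> real n / 2 ^ \<kappa> n < 1 / (8 * real N)"
      by (auto simp: eventually_sequentially)
    have n1': "8 * N * n \<le> 2 ^ \<kappa> n" if "n1 \<le> n" for n
    proof -
      have "real (8 * N * n) < real (2 ^ \<kappa> n)" using n1[OF that] N_ge by (simp add: field_simps)
      then show ?thesis by (simp only: of_nat_less_iff less_imp_le)
    qed
    \<comment> \<open>\<open>0\<close> is inserted below so that the maximum exists for the few \<open>k\<close> with \<open>S k = {}\<close>.\<close>
    define S where "S k = {n. 1 \<le> n \<and> \<kappa> n \<le> k}" for k
    have finS: "finite (S k)" for k
    proof (rule finite_subset)
      show "S k \<subseteq> {..max n1 (2 ^ k)}"
      proof
        fix n assume n: "n \<in> S k"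
        have "n \<le> 2 ^ k" if "n1 \<le> n"
        proof -
          have "n \<le> 8 * N * n" using N_ge by simp
          also have "\<dots> \<le> 2 ^ \<kappa> n" using n1' that .
          also have "\<dots> \<le> 2 ^ k" using n by (simp add: S_def)
          finally show ?thesis .
        qed
        then show "n \<in> {..max n1 (2 ^ k)}" by (cases "n1 \<le> n") auto
      qed
    qed simp
    define l where "l k = Max (insert 0 (S k))" for k
    have l_iff: "n \<le> l k \<longleftrightarrow> \<kappa> n \<le> k" if "1 \<le> n" for n k
    proof
      assume "\<kappa> n \<le> k"
      then show "n \<le> l k" unfolding l_def using finS that by (intro Max_ge) (auto simp: S_def)
    next
      assume "n \<le> l k"
      moreover have "l k \<in> insert 0 (S k)" unfolding l_def using finS by (intro Max_in) auto
      ultimately have "1 \<le> l k" "\<kappa> (l k) \<le> k" using that by (auto simp: S_def)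
      then show "\<kappa> n \<le> k" using mono_onD[OF mono, of n "l k"] \<open>n \<le> l k\<close> that by simp
    qed
    define n2 where "n2 = max n1 (N + 1)"
    define k0 where "k0 = \<kappa> n2"
    have l_ge: "n2 \<le> l k" if "k0 \<le> k" for k
      using that l_iff[of n2 k] by (simp add: n2_def k0_def)
    interpret copy_schedule N k0 l
    proof
      fix k assume k: "k0 \<le> k"
      show "N < l k" using l_ge[OF k] by (simp add: n2_def)
      have "8 * N * l k \<le> 2 ^ \<kappa> (l k)" using l_ge[OF k] by (intro n1') (simp add: n2_def)
      also have "\<dots> \<le> 2 ^ k"
        using l_iff[of "l k" k] l_ge[OF k] by (intro power_increasing) (auto simp: n2_def)
      finally show "8 * N * l k \<le> 2 ^ k" .
    qed (use N_ge in simp)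
    have ret: "return_time n (copying N k0 l y) = enat (2 ^ \<kappa> n)" if "n2 \<le> n" for n y
    proof -
      have "1 \<le> n" "N \<le> n" "1 \<le> n2" using that by (auto simp: n2_def)
      then show ?thesis
        using l_iff[of n] that mono_onD[OF mono, of n2 n]
        by (intro return_time_copying) (auto simp: k0_def not_le[symmetric])
    qed
    show ?thesis
    proof (rule hausdorff_measure_neq_0_of_free_coordinates[where \<Phi> = "copying N k0 l" and F = free and c = "real N + 2"])
      show "copying N k0 l y \<in> ?E" if "y \<in> full_shift m" for y
        using copying_in_full_shift[OF that m] ret by (auto simp: eventually_sequentially)
      show "s * real n - (real N + 2) \<le> real (card (free \<inter> {..<n}))" for n
      proof -
        have "s \<le> 1 - 2 / real N" using N_ge(2) by linarith
        then have "s * real n \<le> real n * (1 - 2 / real N)"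
          by (subst mult.commute) (rule mult_left_mono, simp_all)
        with card_free_ge[of n] show ?thesis by linarith
      qed
    qed (use m s copying_free in auto)
  qed
  then show ?thesis
    using shift_space.hausdorff_dim_geI[of 1 m ?E] by (simp add: one_ereal_def)
qed

section \<open>Rates with prescribed limits\<close>

lemma frequently_less_of_Liminf_less:
  fixes X :: "'b \<Rightarrow> 'a :: complete_linorder"
  assumes "Liminf F X < y"
  shows "\<exists>\<^sub>F x in F. X x < y"
proof (rule ccontr)
  assume "\<not> ?thesis"
  then have "\<forall>\<^sub>F x in F. y \<le> X x" by (simp add: not_frequently not_less)
  then have "y \<le> Liminf F X" by (rule Liminf_bounded)
  with assms show False by simp
qed

lemma frequently_greater_of_less_Limsup:
  fixes X :: "'b \<Rightarrow> 'a :: complete_linorder"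
  assumes "y < Limsup F X"
  shows "\<exists>\<^sub>F x in F. y < X x"
proof (rule ccontr)
  assume "\<not> ?thesis"
  then have "\<forall>\<^sub>F x in F. X x \<le> y" by (simp add: not_frequently not_less)
  then have "Limsup F X \<le> y" by (rule Limsup_bounded)
  with assms show False by simp
qed

lemma Liminf_le_of_frequently:
  fixes X :: "'b \<Rightarrow> 'a :: complete_linorder"
  assumes "\<exists>\<^sub>F x in F. X x \<le> C"
  shows "Liminf F X \<le> C"
proof (rule ccontr)
  assume "\<not> ?thesis"
  then have "C < Liminf F X" by simp
  then have "\<forall>\<^sub>F x in F. C < X x" by (rule less_LiminfD)
  with assms show False by (simp add: frequently_def not_le)
qed

lemma less_one_divide_ereal_iff:
  fixes \<gamma> :: ereal
  assumes "0 \<le> \<gamma>" "0 < r"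
  shows "ereal r < 1 / \<gamma> \<longleftrightarrow> \<gamma> < ereal (1 / r)"
proof (cases \<gamma>)
  case (real g)
  show ?thesis
  proof (cases "g = 0")
    case False
    then have "0 < g" using assms real by simp
    then have "1 / \<gamma> = ereal (1 / g)" using real by (simp add: one_ereal_def)
    then show ?thesis using \<open>0 < g\<close> assms real by (simp add: field_simps)
  qed (use assms real in \<open>simp add: divide_ereal_def flip: zero_ereal_def\<close>)
qed (use assms in auto)

text \<open>Both ways of violating the conditions on \<open>\<alpha>\<close> and \<open>\<beta>\<close> lead to this hypothesis: at infinitely many
\<open>n\<close>, \<open>ln R\<^sub>n < r1 * \<phi> n < (r1 / r2) * ln n\<close>.\<close>

lemma early_return_of_ratio_less:
  assumes r: "0 < r1" "0 < r2"
    and \<phi>: "\<And>n. n \<ge> 1 \<Longrightarrow> 0 < \<phi> n"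
    and freq: "\<exists>\<^sub>F n in sequentially. ln_enat (return_time n x) / ereal (\<phi> n) < ereal r1
                \<and> \<phi> n / ln (real n) < 1 / r2"
  shows "\<exists>\<^sub>F n in sequentially. return_time n x \<le> enat (nat \<lfloor>real n powr (r1 / r2)\<rfloor>)"
proof -
  have "\<exists>\<^sub>F n in sequentially. (ln_enat (return_time n x) / ereal (\<phi> n) < ereal r1
      \<and> \<phi> n / ln (real n) < 1 / r2) \<and> 2 \<le> n"
    using freq eventually_ge_at_top by (rule frequently_eventually_frequently)
  then show ?thesis
  proof (rule frequently_elim1)
    fix n :: nat
    assume n: "(ln_enat (return_time n x) / ereal (\<phi> n) < ereal r1 \<and> \<phi> n / ln (real n) < 1 / r2) \<and> 2 \<le> n"
    then have pos: "0 < \<phi> n" "0 < ln (real n)" using \<phi>[of n] by auto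
    obtain j where j: "return_time n x = enat j"
      using n pos by (cases "return_time n x") (auto simp: ln_enat_def)
    have "ln (real j) / \<phi> n < r1" using n pos by (simp add: j ln_enat_def)
    then have "ln (real j) < r1 * \<phi> n" using pos by (simp add: pos_divide_less_eq)
    also have "r1 * \<phi> n < r1 * (ln (real n) / r2)"
      using n pos r by (intro mult_strict_left_mono) (simp_all add: field_simps)
    finally have less: "ln (real j) < ln (real n powr (r1 / r2))"
      using n by (simp add: ln_powr)
    have "real j \<le> real n powr (r1 / r2)"
    proof (cases "j = 0")
      case False
      then show ?thesis using less n by (subst (asm) ln_less_cancel_iff) auto
    qed simp
    then have "j \<le> nat \<lfloor>real n powr (r1 / r2)\<rfloor>" by (simp add: le_nat_floor)
    then show "return_time n x \<le> enat (nat \<lfloor>real n powr (r1 / r2)\<rfloor>)" by (simp add: j)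
  qed
qed

lemma hausdorff_dim_ratio_less_eq_0:
  assumes m: "m \<ge> 2" and r: "0 < r1" "r1 < r2" and A: "A \<subseteq> full_shift m"
    and \<phi>: "\<And>n. n \<ge> 1 \<Longrightarrow> 0 < \<phi> n"
    and freq: "\<And>x. x \<in> A \<Longrightarrow> \<exists>\<^sub>F n in sequentially.
                ln_enat (return_time n x) / ereal (\<phi> n) < ereal r1 \<and> \<phi> n / ln (real n) < 1 / r2"
  shows "shift_space.hausdorff_dim m A = 0"
proof (rule hausdorff_dim_early_return_eq_0[OF m _ A])
  show "\<exists>\<^sub>F n in sequentially. return_time n x \<le> enat (nat \<lfloor>real n powr (r1 / r2)\<rfloor>)" if "x \<in> A" for x
    using early_return_of_ratio_less[OF _ _ \<phi> freq[OF that]] r by simp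
  have le: "norm (real (nat \<lfloor>real n powr (r1 / r2)\<rfloor>) / real n) \<le> real n powr (r1 / r2) / real n" for n
    by (auto intro!: divide_right_mono)
  have "r1 / r2 < 1" using r by simp
  then have "(\<lambda>n. real n powr (r1 / r2) / real n) \<longlonglongrightarrow> 0" by real_asymp
  then show "(\<lambda>n. real (nat \<lfloor>real n powr (r1 / r2)\<rfloor>) / real n) \<longlonglongrightarrow> 0"
    by (rule Lim_null_comparison[OF always_eventually, OF allI, OF le])
qed

text \<open>\<open>f\<close> is the desired size of \<open>ln R\<^sub>n\<close>; the slack between \<open>f\<close> and \<open>f + 1\<close> leaves room for rounding to
integer multiples of \<open>ln 2\<close>. The function \<open>f\<close> is the maximum of \<open>a * \<phi>\<close>, the barrier \<open>L\<close>, and a step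
function \<open>B\<close> whose \<open>k\<close>-th step, at \<open>Suc (q k)\<close>, has height \<open>b k\<close> times the current value
of \<open>\<phi>\<close>, where \<open>b k\<close> is \<open>\<beta>\<close> if that is finite and increases to \<open>\<infinity>\<close> otherwise. As \<open>\<phi>\<close> is monotone, a step never exceeds \<open>\<beta> * \<phi>\<close> later on,
so the steps produce exactly the upper limit. The next index \<open>q (Suc k)\<close> comes so late that
\<open>L\<close> has overtaken the step, and it is one of the indices where \<open>L\<close> is almost below \<open>a * \<phi>\<close>; there
\<open>f / \<phi>\<close> is close to \<open>a\<close>.\<close>

lemma exists_rate:
  fixes \<phi> L :: "nat \<Rightarrow> real" and a :: real and \<beta> :: ereal
  assumes pos: "\<And>n. n \<ge> 1 \<Longrightarrow> 0 < \<phi> n" and mono: "mono_on {1..} \<phi>"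
    and top: "filterlim \<phi> at_top sequentially"
    and L: "mono L" "filterlim L at_top sequentially"
    and a: "0 \<le> a" "ereal a \<le> \<beta>"
    and low: "\<And>\<epsilon>. \<epsilon> > 0 \<Longrightarrow> \<exists>\<^sub>F n in sequentially. L n \<le> (a + \<epsilon>) * \<phi> n"
    and up: "\<And>b \<epsilon>. \<beta> = ereal b \<Longrightarrow> \<epsilon> > 0 \<Longrightarrow> \<forall>\<^sub>F n in sequentially. L n \<le> (b + \<epsilon>) * \<phi> n"
  shows "\<exists>f. mono_on {1..} f \<and> (\<forall>n\<ge>1. 0 \<le> f n \<and> L n \<le> f n) \<and>
    (\<forall>g. (\<forall>n\<ge>1. f n \<le> g n \<and> g n \<le> f n + 1) \<longrightarrow>
      liminf (\<lambda>n. ereal (g n / \<phi> n)) = ereal a \<and> limsup (\<lambda>n. ereal (g n / \<phi> n)) = \<beta>)"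
proof -
  have phi_le: "\<phi> i \<le> \<phi> j" if "1 \<le> i" "i \<le> j" for i j
    using mono_onD[OF mono, of i j] that by simp
  define b where "b k = (if \<beta> = \<infinity> then a + real k else real_of_ereal \<beta>)" for k
  have b_fin: "\<beta> = ereal (b k)" if "\<beta> \<noteq> \<infinity>" for k
    using that a by (cases \<beta>) (auto simp: b_def)
  have b_ge: "a \<le> b k" for k
    using a by (cases \<beta>) (auto simp: b_def)
  have b_mono: "b j \<le> b k" if "j \<le> k" for j k using that by (simp add: b_def)
  have b_lim: "\<exists>k0. \<forall>k\<ge>k0. y < ereal (b k)" if y: "y < \<beta>" for y
  proof (cases "\<beta> = \<infinity>")
    case True
    obtain z where z: "y < ereal z" using ereal_dense2[OF y] by blast
    obtain k0 :: nat where "z < real k0" using reals_Archimedean2 by blast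
    then have "z < b k" if "k \<ge> k0" for k using that a True by (simp add: b_def)
    then show ?thesis using z by (metis less_ereal.simps(1) order_less_trans)
  next
    case False
    then show ?thesis using that b_fin by metis
  qed
  \<comment> \<open>Candidates for \<open>q k\<close>; the bound on \<open>\<phi> n\<close> makes the rounding slack \<open>1\<close> negligible.\<close>
  define P where "P k n \<longleftrightarrow> 1 \<le> n \<and> L n \<le> (a + 1 / real (Suc k)) * \<phi> n \<and> real (Suc k) \<le> \<phi> n"
    for k n :: nat
  have P_ex: "\<exists>n. P k n \<and> Q n" if "\<forall>\<^sub>F n in sequentially. Q n" for k Q
  proof -
    have "\<forall>\<^sub>F n in sequentially. 1 \<le> n \<and> real (Suc k) \<le> \<phi> n \<and> Q n"
      using that top by (intro eventually_conj eventually_ge_at_top) (auto simp: filterlim_at_top)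
    with low[of "1 / real (Suc k)"]
    have "\<exists>\<^sub>F n in sequentially. L n \<le> (a + 1 / real (Suc k)) * \<phi> n \<and> (1 \<le> n \<and> real (Suc k) \<le> \<phi> n \<and> Q n)"
      by (intro frequently_eventually_frequently) simp_all
    then obtain n where "L n \<le> (a + 1 / real (Suc k)) * \<phi> n \<and> (1 \<le> n \<and> real (Suc k) \<le> \<phi> n \<and> Q n)"
      by (rule frequentlyE)
    then show ?thesis unfolding P_def by blast
  qed
  have "\<exists>q. \<forall>k. P k (q k) \<and> (q k < q (Suc k) \<and> b k * \<phi> (Suc (q k)) \<le> L (q (Suc k)))"
  proof (rule dependent_nat_choice)
    show "\<exists>n. P 0 n" using P_ex[of "\<lambda>_. True" 0] by auto
    fix n k
    have "\<forall>\<^sub>F n' in sequentially. n < n' \<and> b k * \<phi> (Suc n) \<le> L n'"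
      using L(2) by (intro eventually_conj eventually_gt_at_top) (auto simp: filterlim_at_top)
    from P_ex[OF this] show "\<exists>n'. P (Suc k) n' \<and> (n < n' \<and> b k * \<phi> (Suc n) \<le> L n')" .
  qed
  then obtain q where q: "\<And>k. P k (q k)" "\<And>k. q k < q (Suc k)" "\<And>k. b k * \<phi> (Suc (q k)) \<le> L (q (Suc k))"
    by blast
  have q_mono: "strict_mono q" using q(2) by (simp add: strict_mono_Suc_iff)
  have q_ge: "k \<le> q k" for k using q_mono by (rule strict_mono_imp_increasing)
  define K where "K n = {k. Suc (q k) \<le> n}" for n
  define B where "B n = Max (insert 0 ((\<lambda>k. b k * \<phi> (Suc (q k))) ` K n))" for n
  have finK: "finite (K n)" for n
  proof (rule finite_subset)
    show "K n \<subseteq> {..n}" using q_ge by (force simp: K_def intro: order_trans)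
  qed simp
  have B_mono: "B i \<le> B j" if "i \<le> j" for i j
    unfolding B_def using finK that by (intro Max_mono) (auto simp: K_def)
  have B_ge: "b k * \<phi> (Suc (q k)) \<le> B n" if "Suc (q k) \<le> n" for k n
    unfolding B_def using finK that by (intro Max_ge) (auto simp: K_def)
  have B_le: "B n \<le> c" if "0 \<le> c" "\<And>k. Suc (q k) \<le> n \<Longrightarrow> b k * \<phi> (Suc (q k)) \<le> c" for n c
    unfolding B_def using finK that by (intro Max.boundedI) (auto simp: K_def)
  define f where "f n = max (a * \<phi> n) (max (L n) (B n))" for n
  have f_mono: "mono_on {1..} f"
  proof (rule mono_onI)
    fix i j :: nat assume "i \<in> {1..}" "j \<in> {1..}" "i \<le> j"
    then show "f i \<le> f j"
      unfolding f_def using a phi_le[of i j] monoD[OF L(1), of i j] B_mono[of i j]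
      by (intro max.mono mult_left_mono) auto
  qed
  have f_q: "f (q (Suc k)) \<le> (a + 1 / real (Suc (Suc k))) * \<phi> (q (Suc k))" for k
  proof -
    let ?n = "q (Suc k)"
    have Pn: "1 \<le> ?n" "L ?n \<le> (a + 1 / real (Suc (Suc k))) * \<phi> ?n"
      using q(1)[of "Suc k"] by (simp_all add: P_def)
    have b0: "0 \<le> b j" for j using a b_ge order_trans by blast
    have "B ?n \<le> L ?n"
    proof (rule B_le)
      have "0 \<le> b k * \<phi> (Suc (q k))" using b0 pos by (simp add: less_imp_le)
      then show "0 \<le> L ?n" using q(3)[of k] by linarith
      fix j assume "Suc (q j) \<le> ?n"
      then have "j \<le> k" using strict_mono_less[OF q_mono, of j "Suc k"] by simp
      then have "b j * \<phi> (Suc (q j)) \<le> b k * \<phi> (Suc (q k))"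
        using b0 pos[of "Suc (q j)"] strict_mono_less_eq[OF q_mono]
        by (intro mult_mono b_mono phi_le) auto
      then show "b j * \<phi> (Suc (q j)) \<le> L ?n" using q(3)[of k] by linarith
    qed
    moreover have "a * \<phi> ?n \<le> (a + 1 / real (Suc (Suc k))) * \<phi> ?n"
      using pos[OF Pn(1)] by (intro mult_right_mono) auto
    ultimately show ?thesis using Pn(2) by (simp add: f_def)
  qed
  have "liminf (\<lambda>n. ereal (g n / \<phi> n)) = ereal a \<and> limsup (\<lambda>n. ereal (g n / \<phi> n)) = \<beta>"
    if g: "\<forall>n\<ge>1. f n \<le> g n \<and> g n \<le> f n + 1" for g
  proof (intro conjI antisym)
    have "ereal a \<le> ereal (g n / \<phi> n)" if "n \<ge> 1" for n
    proof -
      have "a * \<phi> n \<le> g n" using g that by (force simp: f_def)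
      then show ?thesis using pos[OF that] by (simp add: field_simps)
    qed
    then show "ereal a \<le> liminf (\<lambda>n. ereal (g n / \<phi> n))"
      by (intro Liminf_bounded eventually_sequentiallyI[of 1])
    show "liminf (\<lambda>n. ereal (g n / \<phi> n)) \<le> ereal a"
    proof (rule ereal_le_epsilon2)
      fix e :: real assume e: "0 < e"
      obtain k0 :: nat where k0: "2 / e < real k0" using reals_Archimedean2 by blast
      have "g (q (Suc k)) / \<phi> (q (Suc k)) < a + e" if k: "k0 \<le> k" for k
      proof -
        let ?n = "q (Suc k)" and ?K = "real (Suc (Suc k))"
        have n: "1 \<le> ?n" "?K \<le> \<phi> ?n" using q(1)[of "Suc k"] by (simp_all add: P_def)
        have "g ?n \<le> (a + 1 / ?K) * \<phi> ?n + 1" using g n f_q[of k] by force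
        moreover have "1 \<le> 1 / ?K * \<phi> ?n" using n by (simp add: field_simps)
        moreover have "(a + 2 / ?K) * \<phi> ?n = (a + 1 / ?K) * \<phi> ?n + 1 / ?K * \<phi> ?n"
          by (simp add: distrib_right add_divide_distrib[symmetric])
        ultimately have "g ?n \<le> (a + 2 / ?K) * \<phi> ?n" by linarith
        moreover have "2 / ?K < e"
        proof -
          have "2 / e < ?K" using k0 k by simp
          then show ?thesis using e by (simp add: field_simps)
        qed
        then have "(a + 2 / ?K) * \<phi> ?n < (a + e) * \<phi> ?n"
          using pos[OF n(1)] by (intro mult_strict_right_mono add_strict_left_mono)
        ultimately have "g ?n < (a + e) * \<phi> ?n" by linarith
        then show ?thesis using pos[OF n(1)] by (simp add: pos_divide_less_eq)
      qed
      then have small: "ereal (g (q (Suc k)) / \<phi> (q (Suc k))) \<le> ereal a + ereal e" if "k0 \<le> k" for k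
        using that by (simp add: less_imp_le)
      show "liminf (\<lambda>n. ereal (g n / \<phi> n)) \<le> ereal a + ereal e"
      proof (rule Liminf_le_of_frequently, unfold frequently_sequentially, intro allI exI conjI)
        show "N \<le> q (Suc (max N k0))" for N
          using q_ge[of "Suc (max N k0)"] by linarith
      qed (rule small, simp)
    qed
    show "\<beta> \<le> limsup (\<lambda>n. ereal (g n / \<phi> n))"
    proof (rule ccontr)
      assume "\<not> ?thesis"
      then have "limsup (\<lambda>n. ereal (g n / \<phi> n)) < \<beta>" by (simp add: not_le)
      then obtain y where y: "limsup (\<lambda>n. ereal (g n / \<phi> n)) < y" "y < \<beta>"
        using dense by blast
      from Limsup_lessD[OF y(1)] obtain n0 where n0: "\<And>n. n \<ge> n0 \<Longrightarrow> ereal (g n / \<phi> n) < y"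
        by (auto simp: eventually_sequentially)
      obtain k0 where k0: "\<And>k. k \<ge> k0 \<Longrightarrow> y < ereal (b k)" using b_lim[OF y(2)] by blast
      define k where "k = max n0 k0"
      let ?n = "Suc (q k)"
      have "b k * \<phi> ?n \<le> f ?n" using B_ge[of k ?n] by (simp add: f_def)
      moreover have "f ?n \<le> g ?n" using g by simp
      ultimately have "b k * \<phi> ?n \<le> g ?n" by linarith
      then have "b k \<le> g ?n / \<phi> ?n" using pos[of ?n] by (simp add: pos_le_divide_eq)
      moreover have "ereal (g ?n / \<phi> ?n) < y"
        using q_ge[of k] by (intro n0) (simp add: k_def)
      moreover have "y < ereal (b k)" using k0 by (simp add: k_def)
      ultimately show False by (meson ereal_less_eq(3) leD order_less_trans order_less_le_trans)
    qed
    show "limsup (\<lambda>n. ereal (g n / \<phi> n)) \<le> \<beta>"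
    proof (cases "\<beta> = \<infinity>")
      case False
      then have \<beta>: "\<beta> = ereal (b 0)" and b0: "b k = b 0" for k using b_fin by (auto simp: b_def)
      have b0': "0 \<le> b 0" "a \<le> b 0" using a(1) b_ge[of 0] by linarith+
      show ?thesis
      proof (rule ereal_le_epsilon2)
        fix e :: real assume e: "0 < e"
        have "\<forall>\<^sub>F n in sequentially. 2 / e \<le> \<phi> n" using top by (simp add: filterlim_at_top)
        moreover have "\<forall>\<^sub>F n in sequentially. L n \<le> (b 0 + e / 2) * \<phi> n" using up[OF \<beta>] e by simp
        ultimately have "\<forall>\<^sub>F n in sequentially. ereal (g n / \<phi> n) \<le> \<beta> + ereal e"
          using eventually_ge_at_top[of 1]
        proof eventually_elim
          case (elim n)
          have p: "0 < \<phi> n" using pos elim by simp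
          have one: "1 \<le> e / 2 * \<phi> n" using elim(1) e by (simp add: field_simps)
          have "a * \<phi> n \<le> b 0 * \<phi> n" using b0' p by (intro mult_right_mono) auto
          moreover have "B n \<le> b 0 * \<phi> n"
          proof (rule B_le)
            show "0 \<le> b 0 * \<phi> n" using b0' p by simp
            fix k assume "Suc (q k) \<le> n"
            then show "b k * \<phi> (Suc (q k)) \<le> b 0 * \<phi> n"
              using b0[of k] b0' by (simp add: mult_left_mono phi_le)
          qed
          ultimately have "f n \<le> (b 0 + e / 2) * \<phi> n"
            using elim(2) one by (simp add: f_def algebra_simps)
          moreover have "g n \<le> f n + 1" using g elim by simp
          ultimately have "g n \<le> (b 0 + e) * \<phi> n" using one by (simp add: algebra_simps)
          then show ?case using p by (simp add: \<beta> pos_divide_le_eq)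
        qed
        then show "limsup (\<lambda>n. ereal (g n / \<phi> n)) \<le> \<beta> + ereal e" by (rule Limsup_bounded)
      qed
    qed simp
  qed
  moreover have "0 \<le> f n \<and> L n \<le> f n" if "1 \<le> n" for n
    using a(1) pos[OF that] by (simp add: f_def le_max_iff_disj)
  ultimately show ?thesis using f_mono by blast
qed

text \<open>For the lower limit \<open>\<infinity>\<close> any rate that outgrows \<open>\<phi>\<close> will do, also when \<open>\<phi>\<close> is bounded.\<close>

lemma exists_rate_infinite:
  fixes \<phi> L :: "nat \<Rightarrow> real"
  assumes pos: "\<And>n. n \<ge> 1 \<Longrightarrow> 0 < \<phi> n" and mono: "mono_on {1..} \<phi>" and L: "mono L"
  shows "\<exists>f. mono_on {1..} f \<and> (\<forall>n\<ge>1. 0 \<le> f n \<and> L n \<le> f n) \<and>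
    (\<forall>g. (\<forall>n\<ge>1. f n \<le> g n \<and> g n \<le> f n + 1) \<longrightarrow>
      liminf (\<lambda>n. ereal (g n / \<phi> n)) = \<infinity> \<and> limsup (\<lambda>n. ereal (g n / \<phi> n)) = \<infinity>)"
proof -
  define f where "f n = max (real n * \<phi> n) (L n)" for n
  have "mono_on {1..} f"
  proof (rule mono_onI)
    fix i j :: nat assume ij: "i \<in> {1..}" "j \<in> {1..}" "i \<le> j"
    then show "f i \<le> f j"
      unfolding f_def using mono_onD[OF mono ij] monoD[OF L, of i j] pos[of i]
      by (intro max.mono mult_mono) auto
  qed
  moreover have "0 \<le> f n \<and> L n \<le> f n" if "1 \<le> n" for n
    using pos[OF that] by (simp add: f_def le_max_iff_disj)
  moreover have "liminf (\<lambda>n. ereal (g n / \<phi> n)) = \<infinity> \<and> limsup (\<lambda>n. ereal (g n / \<phi> n)) = \<infinity>"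
    if g: "\<forall>n\<ge>1. f n \<le> g n \<and> g n \<le> f n + 1" for g
  proof -
    have "real n \<le> g n / \<phi> n" if "1 \<le> n" for n
    proof -
      have "real n * \<phi> n \<le> g n" using g that by (force simp: f_def)
      then show ?thesis using pos[OF that] by (simp add: pos_le_divide_eq)
    qed
    then have "\<forall>\<^sub>F n in sequentially. real n \<le> g n / \<phi> n"
      by (intro eventually_sequentiallyI[of 1])
    then have "filterlim (\<lambda>n. g n / \<phi> n) at_top sequentially"
      by (rule filterlim_at_top_mono[OF filterlim_real_sequentially])
    then have "(\<lambda>n. ereal (g n / \<phi> n)) \<longlonglongrightarrow> \<infinity>"
      by (simp add: tendsto_PInfty_eq_at_top)
    then show ?thesis by (simp add: lim_imp_Liminf lim_imp_Limsup)
  qed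
  ultimately show ?thesis by blast
qed

text \<open>The barrier \<open>L\<close> is monotone and asymptotic to \<open>ln n\<close>, but its second summand makes
\<open>n / exp (L n)\<close>, and with it \<open>n / 2^\<kappa>(n)\<close>, tend to \<open>0\<close>.\<close>

lemma hausdorff_dim_recurrence_set_ge_1:
  fixes f :: "nat \<Rightarrow> real"
  defines "L \<equiv> \<lambda>n. ln (real n + 1) + ln (1 + ln (real n + 1))"
  assumes m: "m \<ge> 2" and pos: "\<And>n. n \<ge> 1 \<Longrightarrow> 0 < \<phi> n"
    and f: "mono_on {1..} f" "\<And>n. n \<ge> 1 \<Longrightarrow> 0 \<le> f n \<and> L n \<le> f n"
    and lims: "\<And>g. (\<forall>n\<ge>1. f n \<le> g n \<and> g n \<le> f n + 1) \<Longrightarrow>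
      liminf (\<lambda>n. ereal (g n / \<phi> n)) = \<alpha> \<and> limsup (\<lambda>n. ereal (g n / \<phi> n)) = \<beta>"
  shows "1 \<le> shift_space.hausdorff_dim m (recurrence_set m \<phi> \<alpha> \<beta>)"
proof -
  define \<kappa> where "\<kappa> n = nat \<lceil>f n / ln 2\<rceil>" for n
  define g where "g n = real (\<kappa> n) * ln 2" for n
  have ln2: "0 < ln (2::real)" "ln (2::real) \<le> 1" using ln_le_minus_one[of 2] by simp_all
  have g: "f n \<le> g n \<and> g n \<le> f n + 1" if n: "1 \<le> n" for n
  proof -
    have "0 \<le> f n / ln 2" using f(2)[OF n] ln2 by simp
    then have "f n / ln 2 \<le> real (\<kappa> n)" "real (\<kappa> n) \<le> f n / ln 2 + 1"
      unfolding \<kappa>_def by linarith+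
    then show ?thesis using ln2 by (simp add: g_def field_simps)
  qed
  have g_lims: "liminf (\<lambda>n. ereal (g n / \<phi> n)) = \<alpha>" "limsup (\<lambda>n. ereal (g n / \<phi> n)) = \<beta>"
    using lims[of g] g by auto
  have "mono_on {1..} \<kappa>"
    unfolding \<kappa>_def using ln2
    by (intro mono_onI nat_mono ceiling_mono divide_right_mono mono_onD[OF f(1)]) auto
  moreover have "(\<lambda>n. real n / 2 ^ \<kappa> n) \<longlonglongrightarrow> 0"
  proof (rule Lim_null_comparison)
    show "(\<lambda>n. real n / exp (L n)) \<longlonglongrightarrow> 0" unfolding L_def by real_asymp
    show "\<forall>\<^sub>F n in sequentially. norm (real n / 2 ^ \<kappa> n) \<le> real n / exp (L n)"
    proof (rule eventually_sequentiallyI)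
      fix n :: nat assume n: "1 \<le> n"
      have "exp (L n) \<le> exp (g n)" using f(2)[OF n] g[OF n] by simp
      also have "exp (g n) = 2 ^ \<kappa> n"
        unfolding g_def by (simp add: exp_of_nat_mult)
      finally show "norm (real n / 2 ^ \<kappa> n) \<le> real n / exp (L n)"
        by (simp add: divide_left_mono)
    qed
  qed
  ultimately have "1 \<le> shift_space.hausdorff_dim m
      {x \<in> full_shift m. \<forall>\<^sub>F n in sequentially. return_time n x = enat (2 ^ \<kappa> n)}"
    by (rule hausdorff_dim_prescribed_return_times[OF m])
  also have "\<dots> \<le> shift_space.hausdorff_dim m (recurrence_set m \<phi> \<alpha> \<beta>)"
  proof (rule shift_space.hausdorff_dim_mono, clarify)
    fix x assume x: "x \<in> full_shift m" and ev: "\<forall>\<^sub>F n in sequentially. return_time n x = enat (2 ^ \<kappa> n)"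
    from ev eventually_ge_at_top[of 1]
    have eq: "\<forall>\<^sub>F n in sequentially. ln_enat (return_time n x) / ereal (\<phi> n) = ereal (g n / \<phi> n)"
    proof eventually_elim
      case (elim n)
      then show ?case using pos[of n] by (simp add: ln_enat_def g_def ln_realpow)
    qed
    show "x \<in> recurrence_set m \<phi> \<alpha> \<beta>"
      unfolding recurrence_set_def using x Liminf_eq[OF eq] Limsup_eq[OF eq] g_lims by simp
  qed
  finally show ?thesis .
qed

lemma ln_less_of_one_divide_less:
  assumes "\<phi> n / ln (real n) > 1 / r" "0 < r" "2 \<le> n"
  shows "ln (real n) < r * \<phi> n"
proof -
  have "0 < ln (real n)" using assms by simp
  then show ?thesis using assms by (simp add: field_simps)
qed

text \<open>Replacing \<open>ln n\<close> by the barrier costs only an arbitrarily small part of the constant.\<close>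

lemma log_barrier_le_eventually:
  assumes "0 \<le> (c::real)" "0 < e"
  shows "\<forall>\<^sub>F n in sequentially. ln (real n) < (c + e / 2) * \<phi> n \<longrightarrow>
    ln (real n + 1) + ln (1 + ln (real n + 1)) \<le> (c + e) * \<phi> n"
proof -
  define \<eta> where "\<eta> = (c + e) / (c + e / 2)"
  have "\<eta> > 1" using assms by (simp add: \<eta>_def)
  then have "\<forall>\<^sub>F n in sequentially. ln (real n + 1) + ln (1 + ln (real n + 1)) \<le> \<eta> * ln (real n)"
    by real_asymp
  then show ?thesis
  proof (rule eventually_mono, intro impI)
    fix n assume le: "ln (real n + 1) + ln (1 + ln (real n + 1)) \<le> \<eta> * ln (real n)"
      and "ln (real n) < (c + e / 2) * \<phi> n"
    then have "\<eta> * ln (real n) \<le> \<eta> * ((c + e / 2) * \<phi> n)"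
      using \<open>\<eta> > 1\<close> by (intro mult_left_mono) auto
    also have "\<dots> = (c + e) * \<phi> n" using assms by (simp add: \<eta>_def)
    finally show "ln (real n + 1) + ln (1 + ln (real n + 1)) \<le> (c + e) * \<phi> n" using le by linarith
  qed
qed

theorem theorem1p1:
  fixes m :: nat and \<phi> :: "nat \<Rightarrow> real" and \<delta> \<gamma> \<alpha> \<beta> :: ereal
  assumes "m \<ge> 2"
    and "\<forall>n\<ge>1. 0 < \<phi> n"
    and "mono_on {1..} \<phi>"
    and "\<delta> = liminf (\<lambda>n. ereal (\<phi> n / ln (real n)))"
    and "\<gamma> = limsup (\<lambda>n. ereal (\<phi> n / ln (real n)))"
    and "0 \<le> \<alpha>" and "\<alpha> \<le> \<beta>"
  shows "Metric_space.hausdorff_dim (full_shift m) (shift_dist m) (recurrence_set m \<phi> \<alpha> \<beta>) =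
    (if \<alpha> \<ge> 1 / \<gamma> \<and> \<beta> \<ge> 1 / \<delta> then 1 else 0)"
proof -
  have m: "2 \<le> m" and pos: "\<And>n. n \<ge> 1 \<Longrightarrow> 0 < \<phi> n" using assms by auto
  let ?E = "recurrence_set m \<phi> \<alpha> \<beta>"
  let ?L = "\<lambda>n. ln (real n + 1) + ln (1 + ln (real n + 1))"
  have sub: "?E \<subseteq> full_shift m" by (auto simp: recurrence_set_def)
  have "0 \<le> \<delta>"
    unfolding assms(4) using pos
    by (intro Liminf_bounded eventually_sequentiallyI[of 1]) (simp add: less_imp_le)
  moreover have "\<delta> \<le> \<gamma>" unfolding assms by (intro Liminf_le_Limsup) simp
  ultimately have \<gamma>: "0 \<le> \<gamma>" and \<delta>: "0 \<le> \<delta>" by auto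
  show ?thesis
  proof (cases "\<alpha> \<ge> 1 / \<gamma> \<and> \<beta> \<ge> 1 / \<delta>")
    case False
    \<comment> \<open>The gap between \<open>r1\<close> and \<open>r2\<close> yields one exponent \<open>r1 / r2 < 1\<close> for all points of the set.\<close>
    have between: "\<exists>r1 r2. c < ereal r1 \<and> r1 < r2 \<and> ereal r2 < d" if "c < d" for c d :: ereal
      using that by (metis ereal_dense2 less_ereal.simps(1))
    from False consider "\<alpha> < 1 / \<gamma>" | "\<beta> < 1 / \<delta>" by fastforce
    then have "shift_space.hausdorff_dim m ?E = 0"
    proof cases
      case 1
      then obtain r1 r2 where r: "\<alpha> < ereal r1" "r1 < r2" "ereal r2 < 1 / \<gamma>" using between by blast
      have r1: "0 < r1" using r(1) assms(6) by (metis less_ereal.simps(1) order_le_less_trans zero_ereal_def)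
      have "\<gamma> < ereal (1 / r2)" using less_one_divide_ereal_iff[OF \<gamma>, of r2] r r1 by simp
      then have ev: "\<forall>\<^sub>F n in sequentially. ereal (\<phi> n / ln (real n)) < ereal (1 / r2)"
        unfolding assms(5) by (rule Limsup_lessD)
      show ?thesis
      proof (rule hausdorff_dim_ratio_less_eq_0[OF m r1 r(2) sub pos])
        fix x assume "x \<in> ?E"
        then have "liminf (\<lambda>n. ln_enat (return_time n x) / ereal (\<phi> n)) < ereal r1"
          using r(1) by (simp add: recurrence_set_def)
        from frequently_eventually_frequently[OF frequently_less_of_Liminf_less[OF this] ev]
        show "\<exists>\<^sub>F n in sequentially. ln_enat (return_time n x) / ereal (\<phi> n) < ereal r1 \<and> \<phi> n / ln (real n) < 1 / r2"
          by simp
      qed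
    next
      case 2
      then obtain r1 r2 where r: "\<beta> < ereal r1" "r1 < r2" "ereal r2 < 1 / \<delta>" using between by blast
      have r1: "0 < r1"
        using r(1) assms(6,7) by (metis less_ereal.simps(1) order_le_less_trans order_trans zero_ereal_def)
      have "\<delta> < ereal (1 / r2)" using less_one_divide_ereal_iff[OF \<delta>, of r2] r r1 by simp
      then have fr: "\<exists>\<^sub>F n in sequentially. ereal (\<phi> n / ln (real n)) < ereal (1 / r2)"
        unfolding assms(4) by (rule frequently_less_of_Liminf_less)
      show ?thesis
      proof (rule hausdorff_dim_ratio_less_eq_0[OF m r1 r(2) sub pos])
        fix x assume "x \<in> ?E"
        then have "limsup (\<lambda>n. ln_enat (return_time n x) / ereal (\<phi> n)) < ereal r1"
          using r(1) by (simp add: recurrence_set_def)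
        from frequently_eventually_frequently[OF fr Limsup_lessD[OF this]]
        show "\<exists>\<^sub>F n in sequentially. ln_enat (return_time n x) / ereal (\<phi> n) < ereal r1 \<and> \<phi> n / ln (real n) < 1 / r2"
          by (simp add: conj_commute)
      qed
    qed
    with False show ?thesis by auto
  next
    case True
    have L_mono: "mono ?L"
    proof (rule monoI)
      fix i j :: nat assume "i \<le> j"
      then have "ln (real i + 1) \<le> ln (real j + 1)" "0 \<le> ln (real i + 1)" by simp_all
      moreover from this have "ln (1 + ln (real i + 1)) \<le> ln (1 + ln (real j + 1))"
        by (subst ln_le_cancel_iff) linarith+
      ultimately show "?L i \<le> ?L j" by linarith
    qed
    have "\<exists>f. mono_on {1..} f \<and> (\<forall>n\<ge>1. 0 \<le> f n \<and> ?L n \<le> f n) \<and>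
      (\<forall>g. (\<forall>n\<ge>1. f n \<le> g n \<and> g n \<le> f n + 1) \<longrightarrow>
        liminf (\<lambda>n. ereal (g n / \<phi> n)) = \<alpha> \<and> limsup (\<lambda>n. ereal (g n / \<phi> n)) = \<beta>)"
    proof (cases "\<alpha> = \<infinity>")
      case True
      then show ?thesis
        using exists_rate_infinite[OF pos assms(3) L_mono] assms(7) by simp
    next
      case False
      then obtain a where a: "\<alpha> = ereal a" "0 \<le> a" using assms(6) by (cases \<alpha>) auto
      have low: "\<exists>\<^sub>F n in sequentially. ln (real n) < r * \<phi> n" if "a < r" for r
      proof -
        have "\<not> ereal ((a + r) / 2) < 1 / \<gamma>" using True that a by (auto simp: not_less intro: order_trans)
        then have "ereal (1 / ((a + r) / 2)) \<le> \<gamma>"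
          using less_one_divide_ereal_iff[OF \<gamma>, of "(a + r) / 2"] that a by (simp add: not_less)
        moreover have "1 / r < 1 / ((a + r) / 2)" using that a by (simp add: field_simps)
        ultimately have "ereal (1 / r) < \<gamma>" by (meson less_ereal.simps(1) order_less_le_trans)
        then have "\<exists>\<^sub>F n in sequentially. ereal (1 / r) < ereal (\<phi> n / ln (real n))"
          unfolding assms(5) by (rule frequently_greater_of_less_Limsup)
        from frequently_eventually_frequently[OF this eventually_ge_at_top[of 2]]
        show ?thesis using that a by (elim frequently_elim1) (auto intro: ln_less_of_one_divide_less)
      qed
      have up: "\<forall>\<^sub>F n in sequentially. ln (real n) < r * \<phi> n" if "\<beta> = ereal b" "b < r" for b r
      proof -
        have b: "0 \<le> b" using assms(7) a that by simp
        have "\<not> ereal ((b + r) / 2) < 1 / \<delta>" using True that by (auto simp: not_less intro: order_trans)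
        then have "ereal (1 / ((b + r) / 2)) \<le> \<delta>"
          using less_one_divide_ereal_iff[OF \<delta>, of "(b + r) / 2"] that b by (simp add: not_less)
        moreover have "1 / r < 1 / ((b + r) / 2)" using that b by (simp add: field_simps)
        ultimately have "ereal (1 / r) < \<delta>" by (meson less_ereal.simps(1) order_less_le_trans)
        then have "\<forall>\<^sub>F n in sequentially. ereal (1 / r) < ereal (\<phi> n / ln (real n))"
          unfolding assms(4) by (rule less_LiminfD)
        with eventually_ge_at_top[of 2] show ?thesis
          by eventually_elim (use that b in \<open>auto intro: ln_less_of_one_divide_less\<close>)
      qed
      \<comment> \<open>A finite \<open>\<alpha> \<ge> 1 / \<gamma>\<close> forces \<open>\<gamma> > 0\<close>, so \<open>\<phi>\<close> is unbounded.\<close>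
      have "filterlim \<phi> at_top sequentially"
        unfolding filterlim_at_top
      proof
        fix Z :: real
        have "filterlim (\<lambda>n. ln (real n)) at_top sequentially" by real_asymp
        then have "\<forall>\<^sub>F n in sequentially. (a + 1) * Z \<le> ln (real n)" by (simp add: filterlim_at_top)
        then have "\<forall>\<^sub>F n in sequentially. (a + 1) * Z \<le> ln (real n) \<and> 1 \<le> n"
          by (intro eventually_conj eventually_ge_at_top)
        from frequently_eventually_frequently[OF low[of "a + 1"] this]
        obtain n where n: "ln (real n) < (a + 1) * \<phi> n" "(a + 1) * Z \<le> ln (real n)" "1 \<le> n"
          by (auto elim: frequentlyE)
        then have "(a + 1) * Z < (a + 1) * \<phi> n" by linarith
        then have "Z \<le> \<phi> n" using a by simp
        then show "\<forall>\<^sub>F n in sequentially. Z \<le> \<phi> n"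
          using n(3) mono_onD[OF assms(3), of n]
          by (intro eventually_sequentiallyI[of n]) (auto intro: order_trans)
      qed
      moreover have "filterlim ?L at_top sequentially" by real_asymp
      moreover have "\<exists>\<^sub>F n in sequentially. ?L n \<le> (a + e) * \<phi> n" if "0 < e" for e
        using frequently_eventually_frequently[OF low[of "a + e / 2"] log_barrier_le_eventually[where \<phi> = \<phi>, OF a(2) that]] that
        by (auto elim: frequently_elim1)
      moreover have "\<forall>\<^sub>F n in sequentially. ?L n \<le> (b + e) * \<phi> n" if "\<beta> = ereal b" "0 < e" for b e
      proof -
        have "0 \<le> b" using assms(7) a that by simp
        from up[OF that(1), of "b + e / 2"] log_barrier_le_eventually[where \<phi> = \<phi>, OF this that(2)] that(2)
        show ?thesis by (auto elim: eventually_elim2)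
      qed
      ultimately show ?thesis
        using exists_rate[OF pos assms(3) _ L_mono _ a(2)] assms(7) a(1) by simp
    qed
    then obtain f where f: "mono_on {1..} f" "\<And>n. n \<ge> 1 \<Longrightarrow> 0 \<le> f n \<and> ?L n \<le> f n"
      "\<And>g. (\<forall>n\<ge>1. f n \<le> g n \<and> g n \<le> f n + 1) \<Longrightarrow>
        liminf (\<lambda>n. ereal (g n / \<phi> n)) = \<alpha> \<and> limsup (\<lambda>n. ereal (g n / \<phi> n)) = \<beta>"
      by blast
    have "1 \<le> shift_space.hausdorff_dim m ?E"
      by (rule hausdorff_dim_recurrence_set_ge_1[OF m pos f])
    with hausdorff_dim_full_shift_le[OF m sub] True show ?thesis by (auto intro: antisym)
  qed
qed

end
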